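(* Let $J\in\mathbb{C}^{n\times n}$ and let the Kronecker structure of the pencil $J-\mu J^T$ be $$K_J=\big(\mathcal{L}_{s_1}\oplus\dots\oplus\mathcal{L}_{s_a}\big)\oplus\big(\mathcal{Z}_{t_1}\oplus\dots\oplus\mathcal{Z}_{t_b}\big)\oplus\big(J_{m_1}^1\oplus\dots\oplus J_{m_c}^1\big)\oplus\big(J_{n_1}^{-1}\oplus\dots\oplus J_{n_d}^{-1}\big)\oplus\bigoplus_{j=1}^e\mathcal{J}_{p_j}^{\lambda_j},$$ with $\lambda_j\neq\pm1,0,\infty$. Write $\lambda_j\sim\lambda_k$ when $\{\lambda_j,\lambda_j^{-1}\}=\{\lambda_k,\lambda_k^{-1}\}$. Then the complex dimension of the solution space $\{X\in\mathbb{C}^{n\times n}:X^TJ+JX=0\}$ is $D_L+D_Z+D_1+D_{-1}+D_P+D_I$, where \begin{align*} D_L&=\sum_{j=1}^a(s_j+1)+\sum_{j<k}\max(2s_j+1,2s_k+1)+\#\{j<k:s_j=s_k\},\\ D_Z&=\sum_{j=1}^bt_j+\sum_{j<k}\min(2t_j,2t_k),\\ D_1&=\sum_{j=1}^c\Big\lfloor\frac{m_j}{2}\Big\rfloor+\sum_{j<k}\min(m_j,m_k),\qquad D_{-1}=\sum_{j=1}^d\Big\lceil\frac{n_j}{2}\Big\rceil+\sum_{j<k}\min(n_j,n_k),\\ D_P&=\sum_{j=1}^ep_j+\sum_{j<k,\ \lambda_j\sim\lambda_k}\min(2p_j,2p_k),\\ D_I&=\sum_{j=1}^a\Big(n-\sum_{k=1}^a(2s_k+1)\Big)=a\Big(n-\sum_{k=1}^a(2s_k+1)\Big).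 \end{align*}
   Context: The Kronecker structure of a pencil (with indeterminate $\mu$) is its Kronecker canonical form under strict equivalence $A-\mu B\mapsto P(A-\mu B)Q$ with $P,Q$ constant nonsingular complex matrices; the order of blocks is irrelevant. For finite $\lambda$, the symbol $J_r^\lambda$ in a Kronecker structure denotes the $r\times r$ Jordan block pencil with eigenvalue $\lambda$ (Jordan block minus $\mu I_r$), $J_r^\infty$ denotes the $r\times r$ block of the eigenvalue $\infty$ ($I_r-\mu N_r$, $N_r$ the nilpotent Jordan block), and $L_r$ is the $r\times(r+1)$ singular Kronecker block, with $L_r^T$ its transpose ($r\ge0$). The paired blocks are $\mathcal{L}_r=L_r\oplus L_r^T$ (size $(2r+1)\times(2r+1)$), $\mathcal{Z}_r=J_r^0\oplus J_r^\infty$ (size $2r\times2r$), $\mathcal{J}_r^\lambda=J_r^\lambda\oplus J_r^{1/\lambda}$ (size $2r\times2r$). Every pencil $J-\mu J^T$ with $J\in\mathbb{C}^{n\times n}$ has a Kronecker structure of the form displayed in the claim (any of $a,b,c,d,e$ may be $0$). Sums over $j<k$ run over pairs of indices of the blocks concerned. *)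

theory Defs
  imports Complex_Main "Jordan_Normal_Form.Jordan_Normal_Form" "Jordan_Normal_Form.VS_Connect"
begin

definition const_mat :: "complex mat \<Rightarrow> complex poly mat" where
  "const_mat A = map_mat (\<lambda>c. [:c:]) A"

text \<open>The pencil \<open>A - \<mu> B\<close>; the polynomial variable \<^term>\<open>[:0, 1:]\<close> is \<open>\<mu>\<close>.\<close>

definition pencil :: "complex mat \<Rightarrow> complex mat \<Rightarrow> complex poly mat" where
  "pencil A B = const_mat A - [:0, 1:] \<cdot>\<^sub>m const_mat B"

definition strictly_equivalent :: "complex poly mat \<Rightarrow> complex poly mat \<Rightarrow> bool" where
  "strictly_equivalent M M' \<longleftrightarrow>
     (\<exists>P Q. P \<in> carrier_mat (dim_row M) (dim_row M) \<and> invertible_mat P \<and>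
            Q \<in> carrier_mat (dim_col M) (dim_col M) \<and> invertible_mat Q \<and>
            const_mat P * M * const_mat Q = M')"

datatype kronecker_block =
    Jfin nat complex
  | Jinf nat
  | Lblk nat
  | LTblk nat

text \<open>The block \<open>L\<^sub>r\<close> has \<open>-\<mu>\<close> in position \<open>(i, i)\<close> and \<open>1\<close> in position \<open>(i, i + 1)\<close>; other
  conventions for signs or for the two diagonals are strictly equivalent to this one.
  For \<open>r = 0\<close> it is the \<open>0 \<times> 1\<close> matrix, which contributes a zero column to a direct sum.\<close>

definition L_pencil :: "nat \<Rightarrow> complex poly mat" where
  "L_pencil r = pencil (mat r (r + 1) (\<lambda>(i, j). if j = i + 1 then 1 else 0))
                       (mat r (r + 1) (\<lambda>(i, j). if j = i then 1 else 0))"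

fun block_pencil :: "kronecker_block \<Rightarrow> complex poly mat" where
  "block_pencil (Jfin r l) = pencil (jordan_block r l) (1\<^sub>m r)"
| "block_pencil (Jinf r) = pencil (1\<^sub>m r) (jordan_block r 0)"
| "block_pencil (Lblk r) = L_pencil r"
| "block_pencil (LTblk r) = transpose_mat (L_pencil r)"

text \<open>Jordan blocks have size at least 1, whereas \<open>L\<^sub>0\<close> and its transpose are allowed.\<close>

fun proper_block :: "kronecker_block \<Rightarrow> bool" where
  "proper_block (Jfin r l) \<longleftrightarrow> r \<ge> 1"
| "proper_block (Jinf r) \<longleftrightarrow> r \<ge> 1"
| "proper_block (Lblk r) \<longleftrightarrow> True"
| "proper_block (LTblk r) \<longleftrightarrow> True"

text \<open>The order of the blocks in the list is irrelevant, since block permutations are strict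
  equivalences.\<close>

definition has_kronecker_structure :: "complex poly mat \<Rightarrow> kronecker_block list \<Rightarrow> bool" where
  "has_kronecker_structure M bs \<longleftrightarrow>
     (\<forall>b \<in> set bs. proper_block b) \<and>
     strictly_equivalent M (diag_block_mat (map block_pencil bs))"

definition paired_L :: "nat \<Rightarrow> kronecker_block list" where
  "paired_L r = [Lblk r, LTblk r]"

definition paired_Z :: "nat \<Rightarrow> kronecker_block list" where
  "paired_Z r = [Jfin r 0, Jinf r]"

definition paired_J :: "nat \<Rightarrow> complex \<Rightarrow> kronecker_block list" where
  "paired_J r l = [Jfin r l, Jfin r (1 / l)]"

definition sim_eigenvalue :: "complex \<Rightarrow> complex \<Rightarrow> bool" where
  "sim_eigenvalue x y \<longleftrightarrow> {x, 1 / x} = {y, 1 / y}"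

definition solution_space :: "nat \<Rightarrow> complex mat \<Rightarrow> complex mat set" where
  "solution_space n J = {X \<in> carrier_mat n n. transpose_mat X * J + J * X = 0\<^sub>m n n}"

text \<open>The dimension over the complex numbers of a subspace \<open>W\<close> of the \<open>n \<times> n\<close> matrices.\<close>

definition mat_subspace_dim :: "nat \<Rightarrow> complex mat set \<Rightarrow> nat" where
  "mat_subspace_dim n W =
     vectorspace.dim class_ring (module_mat TYPE(complex) n n \<lparr>carrier := W\<rparr>)"

text \<open>The block families are indexed by \<open>0, \<dots>, a - 1\<close> etc.; the following is the set of index
  pairs \<open>j < k\<close>.\<close>

definition index_pairs :: "nat \<Rightarrow> (nat \<times> nat) set" where
  "index_pairs a = {(j, k). j < k \<and> k < a}"

definition D_L :: "nat \<Rightarrow> (nat \<Rightarrow> nat) \<Rightarrow> int" where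
  "D_L a s = (\<Sum>j<a. int (s j + 1))
     + (\<Sum>(j, k)\<in>index_pairs a. int (max (2 * s j + 1) (2 * s k + 1)))
     + int (card {(j, k) \<in> index_pairs a. s j = s k})"

definition D_Z :: "nat \<Rightarrow> (nat \<Rightarrow> nat) \<Rightarrow> int" where
  "D_Z b t = (\<Sum>j<b. int (t j))
     + (\<Sum>(j, k)\<in>index_pairs b. int (min (2 * t j) (2 * t k)))"

definition D_one :: "nat \<Rightarrow> (nat \<Rightarrow> nat) \<Rightarrow> int" where
  "D_one c m = (\<Sum>j<c. \<lfloor>real (m j) / 2\<rfloor>)
     + (\<Sum>(j, k)\<in>index_pairs c. int (min (m j) (m k)))"

definition D_minus_one :: "nat \<Rightarrow> (nat \<Rightarrow> nat) \<Rightarrow> int" where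
  "D_minus_one d q = (\<Sum>j<d. \<lceil>real (q j) / 2\<rceil>)
     + (\<Sum>(j, k)\<in>index_pairs d. int (min (q j) (q k)))"

definition D_P :: "nat \<Rightarrow> (nat \<Rightarrow> nat) \<Rightarrow> (nat \<Rightarrow> complex) \<Rightarrow> int" where
  "D_P e p lam = (\<Sum>j<e. int (p j))
     + (\<Sum>(j, k)\<in>{(j, k) \<in> index_pairs e. sim_eigenvalue (lam j) (lam k)}.
          int (min (2 * p j) (2 * p k)))"

definition D_I :: "nat \<Rightarrow> nat \<Rightarrow> (nat \<Rightarrow> nat) \<Rightarrow> int" where
  "D_I n a s = (\<Sum>j<a. int n - (\<Sum>k<a. int (2 * s k + 1)))"

lemma D_I_product_form: "D_I n a s = int a * (int n - (\<Sum>k<a. int (2 * s k + 1)))"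
  by (simp add: D_I_def)

end

theory Submission
  imports Defs
begin

text \<open>Let \<open>K\<^sub>0 - \<mu> K\<^sub>1 = P (J - \<mu> J\<^sup>T) Q\<close> be the Kronecker form, so that \<open>K\<^sub>0 = P J Q\<close> and
  \<open>K\<^sub>1 = P J\<^sup>T Q\<close>.  The substitution \<open>X = Q C P\<^sup>-\<^sup>T\<close> turns \<open>X\<^sup>T J + J X = 0\<close> into
  \<open>K\<^sub>0 C + (K\<^sub>1 C)\<^sup>T = 0\<close>, an equation in which only the Kronecker form occurs
  (\<open>bij_betw_solution_space\<close>).

  This equation splits along direct sums.  If the form is \<open>A \<oplus> B\<close> and \<open>C\<close> is cut into four blocks
  accordingly, the two diagonal blocks satisfy the same equation for \<open>A\<close> and for \<open>B\<close>
  (\<open>self_space\<close>), while the two off-diagonal blocks \<open>D, E\<close> are only coupled with each other, by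
  \<open>A\<^sub>0 D + (B\<^sub>1 E)\<^sup>T = 0\<close> and \<open>B\<^sub>0 E + (A\<^sub>1 D)\<^sup>T = 0\<close> (\<open>pair_space\<close>).  The dimension is therefore a
  sum of one contribution for each Kronecker block and one for each unordered pair of blocks
  (\<open>has_dim_self_sum_act\<close>).

  The coefficients of a Kronecker block are bidiagonal, so in each case the equations are
  recursions that move entries along diagonals or antidiagonals, and the dimension is the number of
  entries that can be chosen freely.  The contribution of a pair is \<open>min r s\<close> for Jordan blocks of
  sizes \<open>r, s\<close> with reciprocal eigenvalues (counting \<open>0\<close> and \<open>\<infinity>\<close> as reciprocal), \<open>r\<close> for a Jordan
  block of size \<open>r\<close> and any \<open>L\<^sub>s\<close>, \<open>r + s\<close> for \<open>L\<^sub>r\<close> and \<open>L\<^sub>s\<close>, \<open>s + 1 - r\<close> (truncated at \<open>0\<close>) for \<open>L\<^sub>r\<close>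
  and \<open>L\<^sub>s\<^sup>T\<close>, and zero otherwise.  A single block contributes \<open>r\<close> if it is \<open>L\<^sub>r\<close>, and zero if it is
  \<open>L\<^sub>r\<^sup>T\<close> or a Jordan block whose eigenvalue is not \<open>1\<close> or \<open>-1\<close>.  For a Jordan block with eigenvalue
  \<open>\<epsilon> = 1\<close> or \<open>-1\<close>, the solutions of \<open>J C + C\<^sup>T = 0\<close> are the fixed points of the involution
  \<open>C \<mapsto> -(J C)\<^sup>T\<close> on the \<open>r\<close>-dimensional space \<open>{C. J C J\<^sup>T = C}\<close>.  Filtered by antidiagonals, this
  involution has the eigenvalues \<open>-\<epsilon> (-1)\<^sup>k\<close> for \<open>k < r\<close>, so the fixed points are counted by the odd
  \<open>k < r\<close> if \<open>\<epsilon> = 1\<close> and by the even ones if \<open>\<epsilon> = -1\<close>; this is where floor and ceiling come from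
  (\<open>self_Jfin_square_one\<close>).

  What remains is bookkeeping (\<open>total_count_structure\<close>): blocks of different families only interact
  through \<open>L\<^sub>s\<close> and a Jordan block, which yields the term \<open>D\<^sub>I\<close>, and \<open>r + s\<close> together with
  \<open>s + 1 - r\<close> and \<open>r + 1 - s\<close> adds up to the maximum of \<open>2r + 1\<close> and \<open>2s + 1\<close>, plus one if \<open>r = s\<close>.\<close>

section \<open>Dimensions of spaces of coordinate functions\<close>

definition lin :: "(('i \<Rightarrow> complex) \<Rightarrow> ('j \<Rightarrow> complex)) \<Rightarrow> bool" where
  "lin T \<longleftrightarrow> (\<forall>c x y. T (\<lambda>i. x i + c * y i) = (\<lambda>j. T x j + c * T y j))"

definition is_subspace :: "('i \<Rightarrow> complex) set \<Rightarrow> bool" where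
  "is_subspace W \<longleftrightarrow>
     (\<lambda>_. 0) \<in> W \<and> (\<forall>c. \<forall>x\<in>W. \<forall>y\<in>W. (\<lambda>i. x i + c * y i) \<in> W)"

definition coord_space :: "nat \<Rightarrow> (nat \<Rightarrow> complex) set" where
  "coord_space N = {v. \<forall>k\<ge>N. v k = 0}"

text \<open>The coordinate map is required to be linear on the whole ambient function space, not just on the
  subspace.  All maps that occur below (restriction, shift, evaluation) are of this kind, so they
  can be composed without tracking domains.\<close>

definition has_dim :: "('i \<Rightarrow> complex) set \<Rightarrow> nat \<Rightarrow> bool" where
  "has_dim W N \<longleftrightarrow> is_subspace W \<and> (\<exists>\<psi>. lin \<psi> \<and> bij_betw \<psi> W (coord_space N))"

lemma lin_zero: "lin T \<Longrightarrow> T (\<lambda>_. 0) = (\<lambda>_. 0)"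
proof -
  assume "lin T"
  then have "T (\<lambda>i. 0 + (-1) * 0) = (\<lambda>j. T (\<lambda>_. 0) j + (-1) * T (\<lambda>_. 0) j)"
    unfolding lin_def by (rule spec[of _ "-1", THEN spec[of _ "\<lambda>_. 0"], THEN spec[of _ "\<lambda>_. 0"]])
  then show ?thesis by simp
qed

lemma lin_comp: "lin S \<Longrightarrow> lin T \<Longrightarrow> lin (\<lambda>x. S (T x))"
  by (simp add: lin_def)

lemma is_subspace_diff:
  assumes "is_subspace W" "x \<in> W" "y \<in> W"
  shows "(\<lambda>i. x i - y i) \<in> W"
proof -
  have "(\<lambda>i. x i + (-1) * y i) \<in> W" using assms unfolding is_subspace_def by blast
  then show ?thesis by simp
qed

lemma lin_diff: "lin T \<Longrightarrow> T (\<lambda>i. x i - y i) = (\<lambda>j. T x j - T y j)"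
proof -
  assume "lin T"
  then have "T (\<lambda>i. x i + (-1) * y i) = (\<lambda>j. T x j + (-1) * T y j)"
    unfolding lin_def by blast
  then show ?thesis by simp
qed

lemma bij_betw_linI:
  assumes "is_subspace W" "lin \<psi>"
    and "\<And>x. x \<in> W \<Longrightarrow> \<psi> x \<in> V"
    and "\<And>x. x \<in> W \<Longrightarrow> \<psi> x = (\<lambda>_. 0) \<Longrightarrow> x = (\<lambda>_. 0)"
    and "\<And>v. v \<in> V \<Longrightarrow> \<exists>x\<in>W. \<psi> x = v"
  shows "bij_betw \<psi> W V"
proof -
  have "inj_on \<psi> W"
  proof (rule inj_onI)
    fix x y assume xy: "x \<in> W" "y \<in> W" "\<psi> x = \<psi> y"
    have "(\<lambda>i. x i - y i) = (\<lambda>_. 0)"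
      using assms(4)[OF is_subspace_diff[OF assms(1) xy(1,2)]] lin_diff[OF assms(2), of x y] xy(3)
      by simp
    then show "x = y" by (auto simp: fun_eq_iff)
  qed
  moreover have "\<psi> ` W = V" using assms(3,5) by blast
  ultimately show ?thesis by (simp add: bij_betw_def)
qed

lemma has_dim_zero: "has_dim {\<lambda>_. 0} 0"
  unfolding has_dim_def
  by (auto simp: is_subspace_def lin_def coord_space_def bij_betw_def fun_eq_iff
      intro!: exI[of _ "\<lambda>_ _. 0"])

lemma has_dim_isomorphic:
  assumes "is_subspace W" "lin T" "bij_betw T W W'" "has_dim W' N"
  shows "has_dim W N"
proof -
  obtain \<psi> where "lin \<psi>" "bij_betw \<psi> W' (coord_space N)"
    using assms(4) unfolding has_dim_def by blast
  then have "lin (\<lambda>x. \<psi> (T x))" "bij_betw (\<lambda>x. \<psi> (T x)) W (coord_space N)"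
    using lin_comp assms(2) bij_betw_trans[OF assms(3)] by (auto simp: comp_def)
  then show ?thesis using assms(1) unfolding has_dim_def by blast
qed

lemma has_dim_product:
  assumes W: "is_subspace W" and T: "lin T1" "lin T2"
    and bij: "bij_betw (\<lambda>x. (T1 x, T2 x)) W (W1 \<times> W2)"
    and "has_dim W1 N1" "has_dim W2 N2"
  shows "has_dim W (N1 + N2)"
proof -
  obtain \<psi>1 \<psi>2 where p1: "lin \<psi>1" "bij_betw \<psi>1 W1 (coord_space N1)"
    and p2: "lin \<psi>2" "bij_betw \<psi>2 W2 (coord_space N2)"
    using assms(5,6) unfolding has_dim_def by blast
  define \<psi> where "\<psi> x = (\<lambda>k. if k < N1 then \<psi>1 (T1 x) k else \<psi>2 (T2 x) (k - N1))" for x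
  have lin: "lin \<psi>" using lin_comp[OF p1(1) T(1)] lin_comp[OF p2(1) T(2)]
    unfolding \<psi>_def lin_def by (simp add: fun_eq_iff)
  have mem: "T1 x \<in> W1" "T2 x \<in> W2" if "x \<in> W" for x
    using bij_betwE[OF bij] that by auto
  have "bij_betw \<psi> W (coord_space (N1 + N2))"
  proof (rule bij_betw_linI[OF W lin])
    fix x assume x: "x \<in> W"
    have "\<psi>2 (T2 x) \<in> coord_space N2" using mem[OF x] p2 bij_betwE by blast
    then show "\<psi> x \<in> coord_space (N1 + N2)" by (simp add: coord_space_def \<psi>_def)
  next
    fix x assume x: "x \<in> W" and 0: "\<psi> x = (\<lambda>_. 0)"
    have c1: "\<psi>1 (T1 x) \<in> coord_space N1" using mem[OF x] p1 bij_betwE by blast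
    have "\<psi>1 (T1 x) k = 0" for k
      using c1 fun_cong[OF 0, of k] by (cases "k < N1") (auto simp: coord_space_def \<psi>_def)
    moreover have "\<psi>2 (T2 x) k = 0" for k
      using fun_cong[OF 0, of "k + N1"] by (simp add: \<psi>_def)
    ultimately have eq: "\<psi>1 (T1 x) = \<psi>1 (T1 (\<lambda>_. 0))" "\<psi>2 (T2 x) = \<psi>2 (T2 (\<lambda>_. 0))"
      using lin_zero[OF lin_comp[OF p1(1) T(1)]] lin_zero[OF lin_comp[OF p2(1) T(2)]] by auto
    have z: "(\<lambda>_. 0) \<in> W" using W by (simp add: is_subspace_def)
    have "T1 x = T1 (\<lambda>_. 0)" "T2 x = T2 (\<lambda>_. 0)"
      using eq inj_onD[OF bij_betw_imp_inj_on[OF p1(2)]] inj_onD[OF bij_betw_imp_inj_on[OF p2(2)]]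
        mem[OF x] mem[OF z] by auto
    then show "x = (\<lambda>_. 0)" using inj_onD[OF bij_betw_imp_inj_on[OF bij] _ x z] by simp
  next
    fix v assume v: "v \<in> coord_space (N1 + N2)"
    have "(\<lambda>k. if k < N1 then v k else 0) \<in> coord_space N1"
      "(\<lambda>k. v (k + N1)) \<in> coord_space N2" using v by (auto simp: coord_space_def)
    then have "(\<lambda>k. if k < N1 then v k else 0) \<in> \<psi>1 ` W1" "(\<lambda>k. v (k + N1)) \<in> \<psi>2 ` W2"
      using p1(2) p2(2) by (simp_all add: bij_betw_def)
    then obtain y1 y2 where y: "y1 \<in> W1" "\<psi>1 y1 = (\<lambda>k. if k < N1 then v k else 0)"
      "y2 \<in> W2" "\<psi>2 y2 = (\<lambda>k. v (k + N1))"
      by (auto simp del: if_split elim!: imageE)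
    have "(y1, y2) \<in> (\<lambda>x. (T1 x, T2 x)) ` W" using bij y by (simp add: bij_betw_def)
    then obtain x where x: "x \<in> W" "T1 x = y1" "T2 x = y2" by auto
    have "\<psi> x = v" unfolding \<psi>_def x y by auto
    then show "\<exists>x\<in>W. \<psi> x = v" using x by blast
  qed
  then show ?thesis using W lin by (auto simp: has_dim_def)
qed

text \<open>The entries in \<open>F\<close> can be prescribed arbitrarily and determine the solution, so evaluation at \<open>F\<close>
  is a system of coordinates.\<close>

lemma has_dim_free_coords:
  assumes W: "is_subspace W" and F: "finite F"
    and inj: "\<And>x. x \<in> W \<Longrightarrow> (\<And>i. i \<in> F \<Longrightarrow> x i = 0) \<Longrightarrow> x = (\<lambda>_. 0)"
    and surj: "\<And>v. \<exists>x\<in>W. \<forall>i\<in>F. x i = v i"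
  shows "has_dim W (card F)"
proof -
  obtain h where h: "bij_betw h {0..<card F} F" using ex_bij_betw_nat_finite[OF F] by blast
  define \<psi> :: "('a \<Rightarrow> complex) \<Rightarrow> nat \<Rightarrow> complex"
    where "\<psi> x = (\<lambda>k. if k < card F then x (h k) else 0)" for x
  have lin: "lin \<psi>" by (auto simp: \<psi>_def lin_def)
  have "bij_betw \<psi> W (coord_space (card F))"
  proof (rule bij_betw_linI[OF W lin])
    fix x assume x: "x \<in> W" and 0: "\<psi> x = (\<lambda>_. 0)"
    show "x = (\<lambda>_. 0)"
    proof (rule inj[OF x])
      fix i assume "i \<in> F"
      then have "i \<in> h ` {0..<card F}" using h by (simp add: bij_betw_def)
      then obtain k where "k < card F" "h k = i" by auto
      then show "x i = 0" using fun_cong[OF 0, of k] by (simp add: \<psi>_def)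
    qed
  next
    fix v assume v: "v \<in> coord_space (card F)"
    obtain x where x: "x \<in> W" "\<forall>i\<in>F. x i = v (inv_into {0..<card F} h i)"
      using surj[of "\<lambda>i. v (inv_into {0..<card F} h i)"] by auto
    have "x (h k) = v k" if "k < card F" for k
      using that x(2) h by (simp add: bij_betw_def inv_into_f_f image_iff[symmetric])
        (metis atLeast0LessThan imageI inv_into_f_f lessThan_iff)
    then have "\<psi> x = v"
      using v by (auto simp: \<psi>_def coord_space_def fun_eq_iff)
    then show "\<exists>x\<in>W. \<psi> x = v" using x by blast
  qed (auto simp: \<psi>_def coord_space_def)
  then show ?thesis using W lin by (auto simp: has_dim_def)
qed

text \<open>A linear functional that is onto splits off a one-dimensional complement of its kernel.\<close>

lemma has_dim_extend:
  assumes W: "is_subspace W" and w: "w \<in> W" "w k = 1"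
    and dim: "has_dim {x\<in>W. x k = 0} N"
  shows "has_dim W (Suc N)"
proof -
  obtain \<psi>0 where p: "lin \<psi>0" "bij_betw \<psi>0 {x\<in>W. x k = 0} (coord_space N)"
    using dim unfolding has_dim_def by blast
  define T where "T x = (\<lambda>i. x i - x k * w i)" for x
  define \<psi> where "\<psi> x = (\<lambda>m. case m of 0 \<Rightarrow> x k | Suc m \<Rightarrow> \<psi>0 (T x) m)" for x
  have "lin T" by (auto simp: lin_def T_def fun_eq_iff algebra_simps)
  then have linT: "lin (\<lambda>x. \<psi>0 (T x))" by (rule lin_comp[OF p(1)])
  have lin: "lin \<psi>" using linT by (auto simp: lin_def \<psi>_def fun_eq_iff split: nat.split)
  have mem: "T x \<in> {x\<in>W. x k = 0}" if "x \<in> W" for x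
  proof -
    have "(\<lambda>i. x i + (- x k) * w i) \<in> W" using W w that unfolding is_subspace_def by blast
    then show ?thesis using w by (simp add: T_def)
  qed
  have "bij_betw \<psi> W (coord_space (Suc N))"
  proof (rule bij_betw_linI[OF W lin])
    fix x assume x: "x \<in> W"
    have "\<psi>0 (T x) \<in> coord_space N" using mem[OF x] p(2) bij_betwE by blast
    then show "\<psi> x \<in> coord_space (Suc N)" by (auto simp: coord_space_def \<psi>_def split: nat.split)
  next
    fix x assume x: "x \<in> W" and 0: "\<psi> x = (\<lambda>_. 0)"
    have xk: "x k = 0" using fun_cong[OF 0, of 0] by (simp add: \<psi>_def)
    have "\<psi>0 (T x) m = 0" for m using fun_cong[OF 0, of "Suc m"] by (simp add: \<psi>_def)
    then have "\<psi>0 (T x) = \<psi>0 (\<lambda>_. 0)" using lin_zero[OF p(1)] by auto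
    moreover have "(\<lambda>_. 0) \<in> {x\<in>W. x k = 0}" using W by (simp add: is_subspace_def)
    ultimately have "T x = (\<lambda>_. 0)"
      using inj_onD[OF bij_betw_imp_inj_on[OF p(2)]] mem[OF x] by blast
    then show "x = (\<lambda>_. 0)" using xk by (simp add: T_def)
  next
    fix v assume "v \<in> coord_space (Suc N)"
    then have "(\<lambda>m. v (Suc m)) \<in> coord_space N" by (simp add: coord_space_def)
    then have "(\<lambda>m. v (Suc m)) \<in> \<psi>0 ` {x\<in>W. x k = 0}" using p(2) by (simp add: bij_betw_def)
    then obtain y where y: "y \<in> W" "y k = 0" "\<psi>0 y = (\<lambda>m. v (Suc m))" by auto
    have "(\<lambda>i. y i + v 0 * w i) \<in> W" using W w y unfolding is_subspace_def by blast
    moreover have Ty: "T (\<lambda>i. y i + v 0 * w i) = y" using y w by (auto simp: T_def)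
    have "\<psi> (\<lambda>i. y i + v 0 * w i) = v"
      unfolding \<psi>_def Ty using y w by (auto split: nat.split)
    ultimately show "\<exists>x\<in>W. \<psi> x = v" by blast
  qed
  then show ?thesis using W lin by (auto simp: has_dim_def)
qed

text \<open>The dimension is the number of pivots in an echelon form that is read from the last coordinate
  downwards: along the filtration of \<open>W\<close> by the vanishing of all coordinates from \<open>k\<close> on, the
  dimension grows by one exactly at the pivots.\<close>

lemma has_dim_echelon:
  fixes i :: "nat \<Rightarrow> 'i"
  assumes W: "is_subspace W"
    and zero: "\<And>x. x \<in> W \<Longrightarrow> (\<And>k. k < M \<Longrightarrow> x (i k) = 0) \<Longrightarrow> x = (\<lambda>_. 0)"
    and leading: "\<And>k. k < M \<Longrightarrow> k \<in> P \<Longrightarrow> \<exists>w\<in>W. w (i k) = 1 \<and> (\<forall>l. k < l \<and> l < M \<longrightarrow> w (i l) = 0)"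
    and non_leading: "\<And>k x. k < M \<Longrightarrow> k \<notin> P \<Longrightarrow> x \<in> W \<Longrightarrow>
          (\<And>l. k < l \<Longrightarrow> l < M \<Longrightarrow> x (i l) = 0) \<Longrightarrow> x (i k) = 0"
  shows "has_dim W (card (P \<inter> {..<M}))"
proof -
  let ?W = "\<lambda>k. {x\<in>W. \<forall>l. k \<le> l \<and> l < M \<longrightarrow> x (i l) = 0}"
  have "k \<le> M \<Longrightarrow> has_dim (?W k) (card (P \<inter> {..<k}))" for k
  proof (induction k)
    case 0
    have "?W 0 = {\<lambda>_. 0}" using W zero by (auto simp: is_subspace_def)
    then show ?case using has_dim_zero by simp
  next
    case (Suc k)
    then have k: "k < M" by simp
    have split: "?W k = {x \<in> ?W (Suc k). x (i k) = 0}"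
      using k by (auto simp: Suc_le_eq) (metis le_neq_implies_less)
    have sub: "is_subspace (?W (Suc k))" using W by (auto simp: is_subspace_def)
    have IH: "has_dim (?W k) (card (P \<inter> {..<k}))" using Suc by simp
    show ?case
    proof (cases "k \<in> P")
      case True
      obtain w where "w \<in> W" "w (i k) = 1" "\<forall>l. k < l \<and> l < M \<longrightarrow> w (i l) = 0"
        using leading[OF k True] by blast
      then have w: "w \<in> ?W (Suc k)" "w (i k) = 1" by auto
      have "has_dim (?W (Suc k)) (Suc (card (P \<inter> {..<k})))"
        using has_dim_extend[OF sub w, folded split] IH by blast
      moreover have "P \<inter> {..<Suc k} = insert k (P \<inter> {..<k})" using True by auto
      ultimately show ?thesis by simp
    next
      case False
      have "?W (Suc k) \<subseteq> ?W k" unfolding split using non_leading[OF k False] by auto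
      then have "?W (Suc k) = ?W k" by (auto simp: split)
      moreover have "P \<inter> {..<Suc k} = P \<inter> {..<k}" using False less_Suc_eq by auto
      ultimately show ?thesis using IH by simp
    qed
  qed
  from this[of M] show ?thesis by (simp add: not_less[symmetric] cong: conj_cong)
qed

text \<open>The inverse of a coordinate map is a linear isomorphism from the standard space of dimension \<open>N\<close>,
  whose dimension is known.\<close>

lemma mat_subspace_dimI:
  fixes \<psi> :: "complex mat \<Rightarrow> nat \<Rightarrow> complex"
  assumes W: "W \<subseteq> carrier_mat n n" "0\<^sub>m n n \<in> W"
    "\<And>X Y. X \<in> W \<Longrightarrow> Y \<in> W \<Longrightarrow> X + Y \<in> W" "\<And>c X. X \<in> W \<Longrightarrow> c \<cdot>\<^sub>m X \<in> W"
    and add: "\<And>X Y. X \<in> W \<Longrightarrow> Y \<in> W \<Longrightarrow> \<psi> (X + Y) = (\<lambda>k. \<psi> X k + \<psi> Y k)"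
    and scale: "\<And>c X. X \<in> W \<Longrightarrow> \<psi> (c \<cdot>\<^sub>m X) = (\<lambda>k. c * \<psi> X k)"
    and bij: "bij_betw \<psi> W (coord_space N)"
  shows "mat_subspace_dim n W = N"
proof -
  let ?M = "module_mat TYPE(complex) n n \<lparr>carrier := W\<rparr>"
  let ?V = "module_vec TYPE(complex) N"
  have mm: "module class_ring (module_mat TYPE(complex) n n)"
  proof -
    interpret abelian_group "module_mat TYPE(complex) n n" by (rule abelian_group_mat)
    show ?thesis
      by (unfold_locales, unfold class_ring_simps module_mat_simps)
        (auto simp: add_smult_distrib_right_mat add_smult_distrib_left_mat intro!: eq_matI simp: algebra_simps)
  qed
  have sub: "submodule class_ring W (module_mat TYPE(complex) n n)"
    by (rule submodule.intro[OF mm]) (use W in \<open>auto simp: module_mat_simps class_ring_simps\<close>)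
  have vM: "vectorspace class_ring ?M"
    unfolding vectorspace_def using module.submodule_is_module[OF mm sub] class_field
    by (auto simp: class_field_def)
  interpret V: vec_space "TYPE(complex)" N .
  define co where "co v = (\<lambda>k. if k < N then v $ k else (0::complex))" for v :: "complex vec"
  define T where "T v = inv_into W \<psi> (co v)" for v
  have co: "co v \<in> coord_space N" for v by (simp add: co_def coord_space_def)
  have TW: "T v \<in> W" and psiT: "\<psi> (T v) = co v" for v
    using bij co[of v] unfolding T_def bij_betw_def
    by (metis inv_into_into, metis f_inv_into_f)
  have inj: "inj_on \<psi> W" using bij by (simp add: bij_betw_def)
  have Tadd: "T (v + w) = T v + T w" if "v \<in> carrier_vec N" "w \<in> carrier_vec N" for v w
    by (rule inj_onD[OF inj]) (use that in \<open>auto simp: psiT TW W(3) add co_def\<close>)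
  have Tsc: "T (c \<cdot>\<^sub>v v) = c \<cdot>\<^sub>m T v" if "v \<in> carrier_vec N" for c v
    by (rule inj_onD[OF inj]) (use that in \<open>auto simp: psiT TW W(4) scale co_def\<close>)
  have hom: "T \<in> module_hom class_ring ?V ?M"
    unfolding module_hom_def
    by (auto simp: module_vec_simps module_mat_simps class_ring_simps TW Tadd Tsc)
  interpret L: linear_map class_ring ?V ?M T
    unfolding linear_map_def mod_hom_def mod_hom_axioms_def
    using vec_vs[of N] vM hom vec_module[of N] module.submodule_is_module[OF mm sub]
    by simp
  have "inj_on T (carrier_vec N)"
  proof (rule inj_onI)
    fix v w :: "complex vec" assume vw: "v \<in> carrier_vec N" "w \<in> carrier_vec N" "T v = T w"
    then have "co v = co w" using psiT by metis
    then show "v = w" using vw(1,2) unfolding co_def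
      by (intro eq_vecI) (auto simp: fun_eq_iff, metis)
  qed
  moreover have "T ` carrier_vec N = W"
  proof
    show "T ` carrier_vec N \<subseteq> W" using TW by auto
    show "W \<subseteq> T ` carrier_vec N"
    proof
      fix X assume X: "X \<in> W"
      have "co (vec N (\<psi> X)) = \<psi> X"
        using bij_betwE[OF bij] X by (auto simp: co_def coord_space_def fun_eq_iff)
      then have "T (vec N (\<psi> X)) = X" using inj_onD[OF inj _ TW X] psiT by metis
      then show "X \<in> T ` carrier_vec N" by (metis imageI vec_carrier)
    qed
  qed
  ultimately have "V.dim = L.W.dim"
    using L.dim_eq[OF V.fin_dim] by (simp add: module_vec_simps)
  then show ?thesis by (simp add: mat_subspace_dim_def V.dim_is_n)
qed

section \<open>Pencils as pairs of operators and their direct sums\<close>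

text \<open>A pencil \<open>A\<^sub>0 - \<mu> A\<^sub>1\<close> is represented by the action of its two coefficients on column vectors that
  are extended by zero to all indices.  For the bidiagonal coefficients of Kronecker blocks this
  makes boundary cases disappear: a shifted entry \<open>x (i + 1)\<close> is simply zero beyond the end.\<close>

datatype act_pencil =
  ActPencil (nrows: nat) (ncols: nat)
    (act0: "(nat \<Rightarrow> complex) \<Rightarrow> nat \<Rightarrow> complex")
    (act1: "(nat \<Rightarrow> complex) \<Rightarrow> nat \<Rightarrow> complex")

definition lin_pencil :: "act_pencil \<Rightarrow> bool" where
  "lin_pencil A \<longleftrightarrow> lin (act0 A) \<and> lin (act1 A)"

text \<open>The solutions \<open>C\<close> of \<open>A\<^sub>0 C + (A\<^sub>1 C)\<^sup>T = 0\<close>.\<close>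

definition self_space :: "act_pencil \<Rightarrow> (nat \<times> nat \<Rightarrow> complex) set" where
  "self_space A = {x.
     (\<forall>i j. \<not> (i < ncols A \<and> j < nrows A) \<longrightarrow> x (i, j) = 0) \<and>
     (\<forall>i<nrows A. \<forall>j<nrows A. act0 A (\<lambda>k. x (k, j)) i + act1 A (\<lambda>k. x (k, i)) j = 0)}"

text \<open>The solutions \<open>(D, E)\<close> of \<open>A\<^sub>0 D + (B\<^sub>1 E)\<^sup>T = 0\<close> and \<open>B\<^sub>0 E + (A\<^sub>1 D)\<^sup>T = 0\<close>, with \<open>D\<close> stored under
  \<open>Inl\<close> and \<open>E\<close> under \<open>Inr\<close>: the equations for the off-diagonal blocks of a solution for \<open>A \<oplus> B\<close>.\<close>

definition pair_space :: "act_pencil \<Rightarrow> act_pencil \<Rightarrow> ((nat \<times> nat) + (nat \<times> nat) \<Rightarrow> complex) set" where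
  "pair_space A B = {z.
     (\<forall>i j. \<not> (i < ncols A \<and> j < nrows B) \<longrightarrow> z (Inl (i, j)) = 0) \<and>
     (\<forall>i j. \<not> (i < ncols B \<and> j < nrows A) \<longrightarrow> z (Inr (i, j)) = 0) \<and>
     (\<forall>i<nrows A. \<forall>j<nrows B.
        act0 A (\<lambda>k. z (Inl (k, j))) i + act1 B (\<lambda>k. z (Inr (k, i))) j = 0 \<and>
        act0 B (\<lambda>k. z (Inr (k, i))) j + act1 A (\<lambda>k. z (Inl (k, j))) i = 0)}"

definition trunc :: "nat \<Rightarrow> (nat \<Rightarrow> complex) \<Rightarrow> nat \<Rightarrow> complex" where
  "trunc c x = (\<lambda>k. if k < c then x k else 0)"

definition direct_sum :: "act_pencil \<Rightarrow> act_pencil \<Rightarrow> act_pencil" where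
  "direct_sum A B = ActPencil (nrows A + nrows B) (ncols A + ncols B)
     (\<lambda>x i. if i < nrows A then act0 A (trunc (ncols A) x) i
            else act0 B (\<lambda>k. x (k + ncols A)) (i - nrows A))
     (\<lambda>x i. if i < nrows A then act1 A (trunc (ncols A) x) i
            else act1 B (\<lambda>k. x (k + ncols A)) (i - nrows A))"

definition empty_pencil :: act_pencil where
  "empty_pencil = ActPencil 0 0 (\<lambda>_ _. 0) (\<lambda>_ _. 0)"

lemma lin_pencilD:
  assumes "lin_pencil A"
  shows "act0 A (\<lambda>i. x i + c * y i) j = act0 A x j + c * act0 A y j"
    "act1 A (\<lambda>i. x i + c * y i) j = act1 A x j + c * act1 A y j"
    "act0 A (\<lambda>_. 0) j = 0" "act1 A (\<lambda>_. 0) j = 0"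
  using assms lin_zero[of "act0 A"] lin_zero[of "act1 A"] by (simp_all add: lin_pencil_def lin_def)

lemma sum_of_equations:
  fixes p :: complex
  assumes "p + p' = 0" "q + q' = 0"
  shows "p + c * q + (p' + c * q') = 0"
proof -
  have "p + c * q + (p' + c * q') = (p + p') + c * (q + q')" by (simp add: algebra_simps)
  then show ?thesis using assms by simp
qed

lemma is_subspace_self_space: "lin_pencil A \<Longrightarrow> is_subspace (self_space A)"
  unfolding is_subspace_def self_space_def
  by (auto simp: lin_pencilD intro!: sum_of_equations)

lemma is_subspace_pair_space: "lin_pencil A \<Longrightarrow> lin_pencil B \<Longrightarrow> is_subspace (pair_space A B)"
  unfolding is_subspace_def pair_space_def
  by (auto simp: lin_pencilD intro!: sum_of_equations)

lemma lin_trunc: "lin (trunc c)"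
  by (auto simp: lin_def trunc_def)

lemma lin_pencil_direct_sum:
  assumes "lin_pencil A" "lin_pencil B"
  shows "lin_pencil (direct_sum A B)"
proof -
  have shift: "lin (\<lambda>(x::nat\<Rightarrow>complex) k. x (k + ncols A))" by (simp add: lin_def)
  have "lin (\<lambda>x i. if i < n then S (trunc (ncols A) x) i else T (\<lambda>k. x (k + ncols A)) (i - n))"
    if "lin S" "lin T" for S T :: "(nat \<Rightarrow> complex) \<Rightarrow> nat \<Rightarrow> complex" and n
    using lin_comp[OF that(1) lin_trunc[of "ncols A"]] lin_comp[OF that(2) shift] unfolding lin_def by (simp add: fun_eq_iff)
  then show ?thesis using assms by (simp add: lin_pencil_def direct_sum_def)
qed

text \<open>The second and third factor live in different function spaces; they are glued into functions on a
  disjoint sum so that the result for two factors applies.\<close>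

lemma has_dim_product3:
  assumes W: "is_subspace W" and T: "lin T1" "lin T2" "lin T3"
    and bij: "bij_betw (\<lambda>x. (T1 x, T2 x, T3 x)) W (W1 \<times> W2 \<times> W3)"
    and "has_dim W1 N1" "has_dim W2 N2" "has_dim W3 N3"
  shows "has_dim W (N1 + N2 + N3)"
proof -
  let ?W = "{case_sum y z | y z. y \<in> W2 \<and> z \<in> W3}"
  have sub: "is_subspace W2" "is_subspace W3" using assms(7,8) by (auto simp: has_dim_def)
  have eq: "(\<lambda>i. case_sum y z i + c * case_sum y' z' i)
      = case_sum (\<lambda>i. y i + c * y' i) (\<lambda>i. z i + c * z' i)" for c :: complex and y y' z z'
    by (auto simp: fun_eq_iff split: sum.split)
  have z: "(\<lambda>_. 0) = case_sum (\<lambda>_. 0) (\<lambda>_. 0)" by (auto simp: fun_eq_iff split: sum.split)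
  have "is_subspace ?W"
    unfolding is_subspace_def
  proof (intro conjI allI ballI)
    show "(\<lambda>_. 0) \<in> ?W" using sub z unfolding is_subspace_def by blast
    fix c x y assume "x \<in> ?W" "y \<in> ?W"
    then show "(\<lambda>i. x i + c * y i) \<in> ?W"
      using sub unfolding is_subspace_def by (auto simp: eq) blast
  qed
  moreover have "bij_betw (\<lambda>x. (\<lambda>i. x (Inl i), \<lambda>i. x (Inr i))) ?W (W2 \<times> W3)"
    by (rule bij_betw_byWitness[where f' = "\<lambda>(y, z). case_sum y z"]) auto
  moreover have "lin (\<lambda>x i. x (Inl i))" "lin (\<lambda>x i. x (Inr i))" by (auto simp: lin_def)
  ultimately have 23: "has_dim ?W (N2 + N3)" using has_dim_product assms(7,8) by blast
  have "lin (\<lambda>x. case_sum (T2 x) (T3 x))" using T unfolding lin_def by (simp add: eq)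
  moreover have "bij_betw (\<lambda>x. (T1 x, case_sum (T2 x) (T3 x))) W (W1 \<times> ?W)"
  proof -
    have "bij_betw (\<lambda>(x, y, z). (x, case_sum y z)) (W1 \<times> W2 \<times> W3) (W1 \<times> ?W)"
      by (rule bij_betw_byWitness[where f' = "\<lambda>(x, y). (x, \<lambda>i. y (Inl i), \<lambda>i. y (Inr i))"]) auto
    from bij_betw_trans[OF bij this] show ?thesis by (simp add: comp_def)
  qed
  ultimately have "has_dim W (N1 + (N2 + N3))" by (rule has_dim_product[OF W T(1) _ _ assms(6) 23])
  then show ?thesis by (simp add: add.assoc)
qed

text \<open>Cutting a solution into four blocks separates the equations: the two diagonal blocks solve the
  equation of the corresponding summand, and the two off-diagonal blocks form an element of the pair
  space.\<close>

lemma has_dim_self_direct_sum: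
  assumes lin: "lin_pencil A" "lin_pencil B"
    and "has_dim (self_space A) N1" "has_dim (pair_space A B) N2" "has_dim (self_space B) N3"
  shows "has_dim (self_space (direct_sum A B)) (N1 + N2 + N3)"
proof -
  let ?r = "nrows A" and ?c = "ncols A" and ?r' = "nrows B" and ?c' = "ncols B"
  define T1 :: "(nat \<times> nat \<Rightarrow> complex) \<Rightarrow> nat \<times> nat \<Rightarrow> complex"
    where "T1 x = (\<lambda>(i, j). if i < ?c \<and> j < ?r then x (i, j) else 0)" for x
  define T2 :: "(nat \<times> nat \<Rightarrow> complex) \<Rightarrow> nat \<times> nat + nat \<times> nat \<Rightarrow> complex"
    where "T2 x = case_sum (\<lambda>(i, j). if i < ?c then x (i, j + ?r) else 0)
                           (\<lambda>(i, j). if j < ?r then x (i + ?c, j) else 0)" for x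
  define T3 :: "(nat \<times> nat \<Rightarrow> complex) \<Rightarrow> nat \<times> nat \<Rightarrow> complex"
    where "T3 x = (\<lambda>(i, j). x (i + ?c, j + ?r))" for x
  define R where "R = (\<lambda>(y1, z, y3). \<lambda>(i, j).
      if i < ?c then (if j < ?r then y1 (i, j) else z (Inl (i, j - ?r)))
      else (if j < ?r then z (Inr (i - ?c, j)) else y3 (i - ?c, j - ?r) :: complex))"
  have lins: "lin T1" "lin T2" "lin T3"
    by (auto simp: lin_def T1_def T2_def T3_def fun_eq_iff split: sum.split)
  let ?W = "self_space (direct_sum A B)"
  let ?V = "self_space A \<times> pair_space A B \<times> self_space B"
  have "bij_betw (\<lambda>x. (T1 x, T2 x, T3 x)) ?W ?V"
  proof (rule bij_betw_byWitness[where f' = R])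
    show "\<forall>x\<in>?W. R (T1 x, T2 x, T3 x) = x"
      by (auto simp: R_def T1_def T2_def T3_def fun_eq_iff)
    show "\<forall>v\<in>?V. (T1 (R v), T2 (R v), T3 (R v)) = v"
      by (auto simp: R_def T1_def T2_def T3_def fun_eq_iff self_space_def pair_space_def
          split: sum.split)
    show "(\<lambda>x. (T1 x, T2 x, T3 x)) ` ?W \<subseteq> ?V"
    proof (intro image_subsetI)
      fix x assume x: "x \<in> ?W"
      have supp: "x (i, j) = 0" if "\<not> (i < ?c + ?c' \<and> j < ?r + ?r')" for i j
        using x that unfolding self_space_def direct_sum_def by auto
      have eq: "act0 (direct_sum A B) (\<lambda>k. x (k, j)) i + act1 (direct_sum A B) (\<lambda>k. x (k, i)) j = 0"
        if "i < ?r + ?r'" "j < ?r + ?r'" for i j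
        using x that unfolding self_space_def by (auto simp: direct_sum_def)
      have "T1 x \<in> self_space A"
        unfolding self_space_def
      proof (intro CollectI conjI allI impI)
        fix i j assume "i < ?r" "j < ?r"
        then show "act0 A (\<lambda>k. T1 x (k, j)) i + act1 A (\<lambda>k. T1 x (k, i)) j = 0"
          using eq[of i j] by (simp add: T1_def direct_sum_def trunc_def)
      qed (auto simp: T1_def)
      moreover have "T3 x \<in> self_space B"
        unfolding self_space_def
      proof (intro CollectI conjI allI impI)
        fix i j assume "i < ?r'" "j < ?r'"
        then show "act0 B (\<lambda>k. T3 x (k, j)) i + act1 B (\<lambda>k. T3 x (k, i)) j = 0"
          using eq[of "i + ?r" "j + ?r"] by (simp add: T3_def direct_sum_def)
      qed (auto simp: T3_def supp)
      moreover have "T2 x \<in> pair_space A B"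
        unfolding pair_space_def
      proof (intro CollectI conjI allI impI)
        fix i j assume ij: "i < ?r" "j < ?r'"
        show "act0 A (\<lambda>k. T2 x (Inl (k, j))) i + act1 B (\<lambda>k. T2 x (Inr (k, i))) j = 0"
          using ij eq[of i "j + ?r"] by (simp add: T2_def direct_sum_def trunc_def)
        show "act0 B (\<lambda>k. T2 x (Inr (k, i))) j + act1 A (\<lambda>k. T2 x (Inl (k, j))) i = 0"
          using ij eq[of "j + ?r" i] by (simp add: T2_def direct_sum_def trunc_def)
      qed (auto simp: T2_def supp)
      ultimately show "(T1 x, T2 x, T3 x) \<in> ?V" by simp
    qed
    show "R ` ?V \<subseteq> ?W"
    proof (intro image_subsetI)
      fix v assume "v \<in> ?V"
      then obtain y1 z y3 where v: "v = (y1, z, y3)" and y: "y1 \<in> self_space A"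
        "z \<in> pair_space A B" "y3 \<in> self_space B" by auto
      show "R v \<in> ?W"
        unfolding self_space_def
      proof (intro CollectI conjI allI impI)
        have s: "\<not> (i < ?c \<and> j < ?r) \<Longrightarrow> y1 (i, j) = 0" "\<not> (i < ?c \<and> j < ?r') \<Longrightarrow> z (Inl (i, j)) = 0"
          "\<not> (i < ?c' \<and> j < ?r) \<Longrightarrow> z (Inr (i, j)) = 0" "\<not> (i < ?c' \<and> j < ?r') \<Longrightarrow> y3 (i, j) = 0"
          for i j using y unfolding self_space_def pair_space_def by blast+
        fix i j assume "\<not> (i < ncols (direct_sum A B) \<and> j < nrows (direct_sum A B))"
        then have "\<not> (i < ?c + ?c' \<and> j < ?r + ?r')" by (simp add: direct_sum_def)
        then show "R v (i, j) = 0" by (auto simp: v R_def intro!: s)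
      next
        fix i j
        have c1: "trunc ?c (\<lambda>k. R v (k, j)) = (\<lambda>k. y1 (k, j))" if "j < ?r" for j
          using y that by (auto simp: trunc_def fun_eq_iff v R_def self_space_def)
        have c2: "trunc ?c (\<lambda>k. R v (k, j)) = (\<lambda>k. z (Inl (k, j - ?r)))" if "\<not> j < ?r" for j
          using y that by (auto simp: trunc_def fun_eq_iff v R_def pair_space_def)
        have c3: "(\<lambda>k. R v (k + ?c, j)) = (\<lambda>k. z (Inr (k, j)))" if "j < ?r" for j
          using that by (auto simp: fun_eq_iff v R_def)
        have c4: "(\<lambda>k. R v (k + ?c, j)) = (\<lambda>k. y3 (k, j - ?r))" if "\<not> j < ?r" for j
          using that by (auto simp: fun_eq_iff v R_def)
        assume "i < nrows (direct_sum A B)" "j < nrows (direct_sum A B)"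
        then have ij: "i < ?r + ?r'" "j < ?r + ?r'" by (auto simp: direct_sum_def)
        have "i - ?r < ?r'" if "\<not> i < ?r" using ij that by auto
        moreover have "j - ?r < ?r'" if "\<not> j < ?r" using ij that by auto
        ultimately show "act0 (direct_sum A B) (\<lambda>k. R v (k, j)) i
            + act1 (direct_sum A B) (\<lambda>k. R v (k, i)) j = 0"
          using y unfolding self_space_def pair_space_def
          by (cases "i < ?r"; cases "j < ?r") (simp_all add: direct_sum_def c1 c2 c3 c4)
      qed
    qed
  qed
  then show ?thesis
    using has_dim_product3 is_subspace_self_space lin_pencil_direct_sum lin lins assms(3-5) by blast
qed

text \<open>Here only the columns of the first and the rows of the second matrix are cut.\<close>

lemma has_dim_pair_direct_sum:
  assumes lin: "lin_pencil A" "lin_pencil B" "lin_pencil C"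
    and "has_dim (pair_space A B) N1" "has_dim (pair_space A C) N2"
  shows "has_dim (pair_space A (direct_sum B C)) (N1 + N2)"
proof -
  let ?r = "nrows B" and ?c = "ncols B"
  define T1 :: "(nat \<times> nat + nat \<times> nat \<Rightarrow> complex) \<Rightarrow> nat \<times> nat + nat \<times> nat \<Rightarrow> complex"
    where "T1 z = case_sum (\<lambda>(i, j). if j < ?r then z (Inl (i, j)) else 0)
                           (\<lambda>(i, j). if i < ?c then z (Inr (i, j)) else 0)" for z
  define T2 :: "(nat \<times> nat + nat \<times> nat \<Rightarrow> complex) \<Rightarrow> nat \<times> nat + nat \<times> nat \<Rightarrow> complex"
    where "T2 z = case_sum (\<lambda>(i, j). z (Inl (i, j + ?r))) (\<lambda>(i, j). z (Inr (i + ?c, j)))" for z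
  define R :: "(nat \<times> nat + nat \<times> nat \<Rightarrow> complex) \<times> (nat \<times> nat + nat \<times> nat \<Rightarrow> complex)
      \<Rightarrow> nat \<times> nat + nat \<times> nat \<Rightarrow> complex"
    where "R = (\<lambda>(y, z). case_sum
      (\<lambda>(i, j). if j < ?r then y (Inl (i, j)) else z (Inl (i, j - ?r)))
      (\<lambda>(i, j). if i < ?c then y (Inr (i, j)) else z (Inr (i - ?c, j))))"
  have lins: "lin T1" "lin T2"
    by (auto simp: lin_def T1_def T2_def fun_eq_iff split: sum.split)
  let ?W = "pair_space A (direct_sum B C)"
  let ?V = "pair_space A B \<times> pair_space A C"
  have "bij_betw (\<lambda>x. (T1 x, T2 x)) ?W ?V"
  proof (rule bij_betw_byWitness[where f' = R])
    show "\<forall>x\<in>?W. R (T1 x, T2 x) = x"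
      by (auto simp: R_def T1_def T2_def fun_eq_iff split: sum.split)
    show "\<forall>v\<in>?V. (T1 (R v), T2 (R v)) = v"
      by (auto simp: R_def T1_def T2_def fun_eq_iff pair_space_def split: sum.split)
    show "(\<lambda>x. (T1 x, T2 x)) ` ?W \<subseteq> ?V"
    proof (intro image_subsetI)
      fix x assume x: "x \<in> ?W"
      have supp: "\<not> (i < ncols A \<and> j < ?r + nrows C) \<Longrightarrow> x (Inl (i, j)) = 0"
        "\<not> (i < ?c + ncols C \<and> j < nrows A) \<Longrightarrow> x (Inr (i, j)) = 0" for i j
        using x unfolding pair_space_def direct_sum_def by auto
      have eq: "act0 A (\<lambda>k. x (Inl (k, j))) i + act1 (direct_sum B C) (\<lambda>k. x (Inr (k, i))) j = 0"
        "act0 (direct_sum B C) (\<lambda>k. x (Inr (k, i))) j + act1 A (\<lambda>k. x (Inl (k, j))) i = 0"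
        if "i < nrows A" "j < ?r + nrows C" for i j
        using x that unfolding pair_space_def by (auto simp: direct_sum_def)
      have "T1 x \<in> pair_space A B"
        unfolding pair_space_def
      proof (intro CollectI conjI allI impI)
        fix i j assume ij: "i < nrows A" "j < ?r"
        show "act0 A (\<lambda>k. T1 x (Inl (k, j))) i + act1 B (\<lambda>k. T1 x (Inr (k, i))) j = 0"
          "act0 B (\<lambda>k. T1 x (Inr (k, i))) j + act1 A (\<lambda>k. T1 x (Inl (k, j))) i = 0"
          using ij eq[of i j] by (simp_all add: T1_def direct_sum_def trunc_def)
      qed (auto simp: T1_def supp)
      moreover have "T2 x \<in> pair_space A C"
        unfolding pair_space_def
      proof (intro CollectI conjI allI impI)
        fix i j assume ij: "i < nrows A" "j < nrows C"
        show "act0 A (\<lambda>k. T2 x (Inl (k, j))) i + act1 C (\<lambda>k. T2 x (Inr (k, i))) j = 0"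
          "act0 C (\<lambda>k. T2 x (Inr (k, i))) j + act1 A (\<lambda>k. T2 x (Inl (k, j))) i = 0"
          using ij eq[of i "j + ?r"] by (simp_all add: T2_def direct_sum_def)
      qed (auto simp: T2_def supp)
      ultimately show "(T1 x, T2 x) \<in> ?V" by simp
    qed
    show "R ` ?V \<subseteq> ?W"
    proof (intro image_subsetI)
      fix v assume "v \<in> ?V"
      then obtain y z where v: "v = (y, z)" and y: "y \<in> pair_space A B" "z \<in> pair_space A C" by auto
      show "R v \<in> ?W"
        unfolding pair_space_def
      proof (intro CollectI conjI allI impI)
        have s: "\<not> (i < ncols A \<and> j < ?r) \<Longrightarrow> y (Inl (i, j)) = 0"
          "\<not> (i < ncols A \<and> j < nrows C) \<Longrightarrow> z (Inl (i, j)) = 0"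
          for i j using y unfolding pair_space_def by blast+
        fix i j assume "\<not> (i < ncols A \<and> j < nrows (direct_sum B C))"
        then have "\<not> (i < ncols A \<and> j < ?r + nrows C)" by (simp add: direct_sum_def)
        then show "R v (Inl (i, j)) = 0" by (auto simp: v R_def intro!: s)
      next
        have s: "\<not> (i < ?c \<and> j < nrows A) \<Longrightarrow> y (Inr (i, j)) = 0"
          "\<not> (i < ncols C \<and> j < nrows A) \<Longrightarrow> z (Inr (i, j)) = 0"
          for i j using y unfolding pair_space_def by blast+
        fix i j assume "\<not> (i < ncols (direct_sum B C) \<and> j < nrows A)"
        then have "\<not> (i < ?c + ncols C \<and> j < nrows A)" by (simp add: direct_sum_def)
        then show "R v (Inr (i, j)) = 0" by (auto simp: v R_def intro!: s)
      next
        fix i j assume i: "i < nrows A" and j: "j < nrows (direct_sum B C)"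
        have j': "j - ?r < nrows C" if "\<not> j < ?r" using j that by (auto simp: direct_sum_def)
        have c: "trunc ?c (\<lambda>k. R v (Inr (k, i))) = (\<lambda>k. y (Inr (k, i)))"
          "(\<lambda>k. R v (Inr (k + ?c, i))) = (\<lambda>k. z (Inr (k, i)))"
          using y by (auto simp: trunc_def fun_eq_iff v R_def pair_space_def)
        have l: "(\<lambda>k. R v (Inl (k, j))) = (if j < ?r then (\<lambda>k. y (Inl (k, j))) else (\<lambda>k. z (Inl (k, j - ?r))))"
          by (auto simp: v R_def)
        show "act0 A (\<lambda>k. R v (Inl (k, j))) i + act1 (direct_sum B C) (\<lambda>k. R v (Inr (k, i))) j = 0"
          "act0 (direct_sum B C) (\<lambda>k. R v (Inr (k, i))) j + act1 A (\<lambda>k. R v (Inl (k, j))) i = 0"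
          using y i j' unfolding pair_space_def l
          by (simp_all add: direct_sum_def c)
      qed
    qed
  qed
  then show ?thesis
    using has_dim_product is_subspace_pair_space lin_pencil_direct_sum lin lins assms(4,5) by blast
qed

lemma has_dim_self_empty: "has_dim (self_space empty_pencil) 0"
proof -
  have "self_space empty_pencil = {\<lambda>_. 0}" by (auto simp: self_space_def empty_pencil_def fun_eq_iff)
  then show ?thesis using has_dim_zero by simp
qed

lemma has_dim_pair_empty: "has_dim (pair_space A empty_pencil) 0"
proof -
  have "pair_space A empty_pencil = {\<lambda>_. 0}"
    by (auto simp: pair_space_def empty_pencil_def fun_eq_iff) (metis old.sum.exhaust surj_pair)
  then show ?thesis using has_dim_zero by simp
qed

lemma has_dim_pair_commute:
  assumes "lin_pencil A" "lin_pencil B" "has_dim (pair_space A B) N"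
  shows "has_dim (pair_space B A) N"
proof -
  let ?T = "\<lambda>z :: nat \<times> nat + nat \<times> nat \<Rightarrow> complex. case_sum (z \<circ> Inr) (z \<circ> Inl)"
  have "lin ?T" by (auto simp: lin_def fun_eq_iff split: sum.split)
  moreover have "bij_betw ?T (pair_space B A) (pair_space A B)"
    by (rule bij_betw_byWitness[where f' = ?T])
      (auto simp: pair_space_def fun_eq_iff add.commute split: sum.split)
  ultimately show ?thesis
    using has_dim_isomorphic is_subspace_pair_space assms by blast
qed

section \<open>Pairs of Kronecker blocks with only the zero solution\<close>

text \<open>The operators written out for the bidiagonal coefficients of each block; that they agree with the
  matrices is \<open>mat_act_block\<close>.\<close>

fun block_act :: "kronecker_block \<Rightarrow> act_pencil" where
  "block_act (Jfin r l) = ActPencil r r (\<lambda>x i. l * x i + x (Suc i)) (\<lambda>x. x)"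
| "block_act (Jinf r) = ActPencil r r (\<lambda>x. x) (\<lambda>x i. x (Suc i))"
| "block_act (Lblk r) = ActPencil r (Suc r) (\<lambda>x i. x (Suc i)) (\<lambda>x. x)"
| "block_act (LTblk r) = ActPencil (Suc r) r (\<lambda>x i. if i = 0 then 0 else x (i - 1)) (\<lambda>x. x)"

lemma lin_pencil_block_act: "lin_pencil (block_act b)"
  by (cases b) (auto simp: lin_pencil_def lin_def fun_eq_iff algebra_simps)

lemma fun_sum_zeroI:
  assumes "\<And>i j. z (Inl (i, j)) = 0" "\<And>i j. z (Inr (i, j)) = 0"
  shows "z = (\<lambda>_. 0)"
proof
  fix a show "z a = 0" using assms by (cases a) auto
qed

lemma has_dim_pair_trivial:
  assumes "\<And>z i j. z \<in> pair_space (block_act a) (block_act b) \<Longrightarrow> z (Inl (i, j)) = 0"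
    and "\<And>z i j. z \<in> pair_space (block_act a) (block_act b) \<Longrightarrow> z (Inr (i, j)) = 0"
  shows "has_dim (pair_space (block_act a) (block_act b)) 0"
proof -
  have "(\<lambda>_. 0) \<in> pair_space (block_act a) (block_act b)"
    using is_subspace_pair_space lin_pencil_block_act unfolding is_subspace_def by blast
  moreover have "z = (\<lambda>_. 0)" if "z \<in> pair_space (block_act a) (block_act b)" for z
    by (rule fun_sum_zeroI) (fact assms(1)[OF that], fact assms(2)[OF that])
  ultimately have "pair_space (block_act a) (block_act b) = {\<lambda>_. 0}" by blast
  then show ?thesis using has_dim_zero by simp
qed

text \<open>A backward induction over the antidiagonals of a finitely supported array.\<close>

lemma zero_of_diagonal_recursion:
  fixes c :: "nat \<Rightarrow> nat \<Rightarrow> 'a::zero"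
  assumes supp: "\<And>i j. \<not> (i < r \<and> j < s) \<Longrightarrow> c i j = 0"
    and step: "\<And>i j. i < r \<Longrightarrow> j < s \<Longrightarrow>
      (\<And>i' j'. i' + j' > i + j \<Longrightarrow> c i' j' = 0) \<Longrightarrow> c i j = 0"
  shows "c i j = 0"
proof (induction "r + s - (i + j)" arbitrary: i j rule: less_induct)
  case less
  show ?case
  proof (cases "i < r \<and> j < s")
    case True
    show ?thesis
    proof (rule step)
      fix i' j' assume "i' + j' > i + j"
      then have "r + s - (i' + j') < r + s - (i + j)" using True by linarith
      then show "c i' j' = 0" by (rule less)
    qed (use True in auto)
  qed (use supp in blast)
qed

text \<open>Eliminating the second matrix leaves \<open>c i j = c (i + 1) (j + 1)\<close>, which pushes every entry out of
  the support.\<close>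

lemma pair_Jinf_Jinf: "has_dim (pair_space (block_act (Jinf r)) (block_act (Jinf s))) 0"
proof -
  have l: "z (Inl (i, j)) = 0" and r: "z (Inr (j, i)) = 0" if z: "z \<in> pair_space (block_act (Jinf r)) (block_act (Jinf s))" for z i j
  proof -
    have supp: "\<not> (i < r \<and> j < s) \<Longrightarrow> z (Inl (i, j)) = 0"
      "\<not> (j < s \<and> i < r) \<Longrightarrow> z (Inr (j, i)) = 0"
      for i j
      using z unfolding pair_space_def by auto
    have eq: "z (Inl (i, j)) + z (Inr (Suc j, i)) = 0" "z (Inr (j, i)) + z (Inl (Suc i, j)) = 0"
      if "i < r" "j < s" for i j using z that unfolding pair_space_def by auto
    have c: "z (Inl (i, j)) = 0" for i j
    proof (rule zero_of_diagonal_recursion[of r s "\<lambda>i j. z (Inl (i, j))"])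
      fix i j assume ij: "i < r" "j < s" and h: "\<And>i' j'. i' + j' > i + j \<Longrightarrow> z (Inl (i', j')) = 0"
      have "z (Inr (Suc j, i)) = 0"
        using supp(2)[of "Suc j" i] eq(2)[of i "Suc j"] ij h[of "Suc i" "Suc j"] by (cases "Suc j < s") auto
      then show "z (Inl (i, j)) = 0" using eq(1)[OF ij] by simp
    qed (use supp in auto)
    show "z (Inl (i, j)) = 0" by (rule c)
    show "z (Inr (j, i)) = 0" using supp(2)[of j i] eq(2)[of i j] c by (cases "i < r \<and> j < s") auto
  qed
  show ?thesis by (rule has_dim_pair_trivial) (use l r in blast)+
qed

text \<open>The extra row of \<open>L\<^sub>s\<^sup>T\<close> forces the first column of the first matrix to vanish, and the equations
  propagate this from each column to the next.\<close>

lemma pair_Jfin_LT: "has_dim (pair_space (block_act (Jfin r l)) (block_act (LTblk s))) 0"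
proof -
  have l: "z (Inl (i, j)) = 0" and r: "z (Inr (j, i)) = 0"
    if z: "z \<in> pair_space (block_act (Jfin r l)) (block_act (LTblk s))" for z i j
  proof -
    have supp: "\<not> (i < r \<and> j < Suc s) \<Longrightarrow> z (Inl (i, j)) = 0"
      "\<not> (j < s \<and> i < r) \<Longrightarrow> z (Inr (j, i)) = 0"
      for i j
      using z unfolding pair_space_def by auto
    have eq: "l * z (Inl (i, j)) + z (Inl (Suc i, j)) + z (Inr (j, i)) = 0"
      "(if j = 0 then 0 else z (Inr (j - 1, i))) + z (Inl (i, j)) = 0"
      if "i < r" "j < Suc s" for i j using z that unfolding pair_space_def by auto
    have c: "\<forall>i. z (Inl (i, j)) = 0" if "j < Suc s" for j
      using that
    proof (induction j)
      case 0
      then show ?case using supp eq(2)[of _ 0] by (metis add_0)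
    next
      case (Suc j)
      show ?case
      proof
        fix i
        show "z (Inl (i, Suc j)) = 0"
          using supp(1)[of i "Suc j"] eq(1)[of i j] eq(2)[of i "Suc j"] Suc by (cases "i < r") auto
      qed
    qed
    show "z (Inl (i, j)) = 0" using c[of j] supp(1)[of i j] by (cases "j < Suc s") auto
    show "z (Inr (j, i)) = 0" using c[of j] supp(2)[of j i] eq(1)[of i j] by (cases "i < r \<and> j < s") auto
  qed
  show ?thesis by (rule has_dim_pair_trivial) (use l r in blast)+
qed

text \<open>As for finite eigenvalues, but the zeros now propagate backwards through the rows of the second
  matrix, starting behind its last row, because the shift sits in the other coefficient.\<close>

lemma pair_Jinf_LT: "has_dim (pair_space (block_act (Jinf r)) (block_act (LTblk s))) 0"
proof -
  have l: "z (Inl (i, j)) = 0" and r: "z (Inr (j, i)) = 0"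
    if z: "z \<in> pair_space (block_act (Jinf r)) (block_act (LTblk s))" for z i j
  proof -
    have supp: "\<not> (i < r \<and> j < Suc s) \<Longrightarrow> z (Inl (i, j)) = 0"
      "\<not> (j < s \<and> i < r) \<Longrightarrow> z (Inr (j, i)) = 0"
      for i j
      using z unfolding pair_space_def by auto
    have eq: "z (Inl (i, j)) + z (Inr (j, i)) = 0"
      "(if j = 0 then 0 else z (Inr (j - 1, i))) + z (Inl (Suc i, j)) = 0"
      if "i < r" "j < Suc s" for i j using z that unfolding pair_space_def by auto
    have d: "\<forall>i. z (Inr (s - k, i)) = 0" for k
    proof (induction k)
      case 0
      then show ?case using supp by simp
    next
      case (Suc k)
      show ?case
      proof (cases "k < s")
        case False
        then show ?thesis using Suc by simp
      next
        case True
        show ?thesis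
        proof
          fix i
          have sk: "s - k = Suc (s - Suc k)" using True by simp
          have "z (Inl (Suc i, s - k)) = 0"
            using Suc supp(1)[of "Suc i" "s - k"] eq(1)[of "Suc i" "s - k"] by (cases "Suc i < r") auto
          then show "z (Inr (s - Suc k, i)) = 0"
            using supp(2)[of "s - Suc k" i] eq(2)[of i "s - k"] True sk by (cases "i < r") auto
        qed
      qed
    qed
    show d': "z (Inr (j, i)) = 0" using d[of "s - j"] supp(2)[of j i] by (cases "j < s") auto
    show "z (Inl (i, j)) = 0" using supp(1)[of i j] eq(1)[of i j] d' by (cases "i < r \<and> j < Suc s") auto
  qed
  show ?thesis by (rule has_dim_pair_trivial) (use l r in blast)+
qed

text \<open>Each equation expresses an entry through one on the previous antidiagonal of the other matrix.\<close>

lemma pair_LT_LT: "has_dim (pair_space (block_act (LTblk r)) (block_act (LTblk s))) 0"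
proof -
  have l: "z (Inl (i, j)) = 0" and r: "z (Inr (j, i)) = 0"
    if z: "z \<in> pair_space (block_act (LTblk r)) (block_act (LTblk s))" for z i j
  proof -
    have supp: "\<not> (i < r \<and> j < Suc s) \<Longrightarrow> z (Inl (i, j)) = 0"
      "\<not> (j < s \<and> i < Suc r) \<Longrightarrow> z (Inr (j, i)) = 0"
      for i j
      using z unfolding pair_space_def by auto
    have eq: "(if i = 0 then 0 else z (Inl (i - 1, j))) + z (Inr (j, i)) = 0"
      "(if j = 0 then 0 else z (Inr (j - 1, i))) + z (Inl (i, j)) = 0"
      if "i < Suc r" "j < Suc s" for i j using z that unfolding pair_space_def by auto
    have "\<forall>i j. i + j = k \<longrightarrow> z (Inl (i, j)) = 0 \<and> z (Inr (j, i)) = 0" for k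
    proof (induction k)
      case 0
      show ?case using eq[of 0 0] by simp
    next
      case (Suc k)
      show ?case
      proof (intro allI impI)
        fix i j assume ij: "i + j = Suc k"
        show "z (Inl (i, j)) = 0 \<and> z (Inr (j, i)) = 0"
        proof (cases "i < Suc r \<and> j < Suc s")
          case True
          have "i - 1 + j = k" if "i \<noteq> 0" using ij that by simp
          moreover have "i + (j - 1) = k" if "j \<noteq> 0" using ij that by simp
          ultimately have "i \<noteq> 0 \<longrightarrow> z (Inl (i - 1, j)) = 0" "j \<noteq> 0 \<longrightarrow> z (Inr (j - 1, i)) = 0"
            using Suc by blast+
          then show ?thesis using eq[of i j] True by (auto split: if_splits)
        next
          case False
          then show ?thesis using supp[of i j] supp(2)[of j i] by auto
        qed
      qed
    qed
    then show "z (Inl (i, j)) = 0" "z (Inr (j, i)) = 0" by auto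
  qed
  show ?thesis by (rule has_dim_pair_trivial) (use l r in blast)+
qed

text \<open>Up to entries on later antidiagonals the equations say \<open>(1 - l v) c i j = 0\<close>.\<close>

lemma pair_Jfin_Jfin_trivial:
  assumes "l * v \<noteq> 1"
  shows "has_dim (pair_space (block_act (Jfin r l)) (block_act (Jfin s v))) 0"
proof -
  have l: "z (Inl (i, j)) = 0" and r: "z (Inr (j, i)) = 0"
    if z: "z \<in> pair_space (block_act (Jfin r l)) (block_act (Jfin s v))" for z i j
  proof -
    have supp: "\<not> (i < r \<and> j < s) \<Longrightarrow> z (Inl (i, j)) = 0"
      "\<not> (j < s \<and> i < r) \<Longrightarrow> z (Inr (j, i)) = 0"
      for i j
      using z unfolding pair_space_def by auto
    have eq: "l * z (Inl (i, j)) + z (Inl (Suc i, j)) + z (Inr (j, i)) = 0"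
      "v * z (Inr (j, i)) + z (Inr (Suc j, i)) + z (Inl (i, j)) = 0"
      if "i < r" "j < s" for i j using z that unfolding pair_space_def by auto
    have c: "z (Inl (i, j)) = 0" for i j
    proof (rule zero_of_diagonal_recursion[of r s "\<lambda>i j. z (Inl (i, j))"])
      fix i j assume ij: "i < r" "j < s" and h: "\<And>i' j'. i' + j' > i + j \<Longrightarrow> z (Inl (i', j')) = 0"
      have "z (Inr (Suc j, i)) = 0"
        using supp(2)[of "Suc j" i] eq(1)[of i "Suc j"] ij h[of i "Suc j"] h[of "Suc i" "Suc j"] by (cases "Suc j < s") auto
      moreover have "z (Inr (j, i)) = - l * z (Inl (i, j))"
        using eq(1)[OF ij] h[of "Suc i" j] by (simp add: add_eq_0_iff2)
      ultimately have "(1 - l * v) * z (Inl (i, j)) = 0" using eq(2)[OF ij] by (simp add: algebra_simps)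
      then show "z (Inl (i, j)) = 0" using assms by auto
    qed (use supp in auto)
    show "z (Inl (i, j)) = 0" by (rule c)
    show "z (Inr (j, i)) = 0" using supp(2)[of j i] eq(1)[of i j] c by (cases "i < r \<and> j < s") auto
  qed
  show ?thesis by (rule has_dim_pair_trivial) (use l r in blast)+
qed

lemma pair_Jfin_Jinf_trivial:
  assumes "l \<noteq> 0"
  shows "has_dim (pair_space (block_act (Jfin r l)) (block_act (Jinf s))) 0"
proof -
  have l: "z (Inl (i, j)) = 0" and r: "z (Inr (j, i)) = 0"
    if z: "z \<in> pair_space (block_act (Jfin r l)) (block_act (Jinf s))" for z i j
  proof -
    have supp: "\<not> (i < r \<and> j < s) \<Longrightarrow> z (Inl (i, j)) = 0"
      "\<not> (j < s \<and> i < r) \<Longrightarrow> z (Inr (j, i)) = 0"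
      for i j
      using z unfolding pair_space_def by auto
    have eq: "l * z (Inl (i, j)) + z (Inl (Suc i, j)) + z (Inr (Suc j, i)) = 0"
      "z (Inr (j, i)) + z (Inl (i, j)) = 0"
      if "i < r" "j < s" for i j using z that unfolding pair_space_def by auto
    have c: "z (Inl (i, j)) = 0" for i j
    proof (rule zero_of_diagonal_recursion[of r s "\<lambda>i j. z (Inl (i, j))"])
      fix i j assume ij: "i < r" "j < s" and h: "\<And>i' j'. i' + j' > i + j \<Longrightarrow> z (Inl (i', j')) = 0"
      have "z (Inr (Suc j, i)) = 0"
        using supp(2)[of "Suc j" i] eq(2)[of i "Suc j"] ij h[of i "Suc j"] by (cases "Suc j < s") auto
      then have "l * z (Inl (i, j)) = 0" using eq(1)[OF ij] h[of "Suc i" j] by simp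
      then show "z (Inl (i, j)) = 0" using assms by auto
    qed (use supp in auto)
    show "z (Inl (i, j)) = 0" by (rule c)
    show "z (Inr (j, i)) = 0" using supp(2)[of j i] eq(2)[of i j] c by (cases "i < r \<and> j < s") auto
  qed
  show ?thesis by (rule has_dim_pair_trivial) (use l r in blast)+
qed

section \<open>Pairs of Kronecker blocks with free entries\<close>

lemma has_dim_pair_free_coords:
  assumes "finite F"
    and "\<And>z. z \<in> pair_space (block_act a) (block_act b) \<Longrightarrow> (\<And>i. i \<in> F \<Longrightarrow> z i = 0) \<Longrightarrow>
           (\<forall>i j. z (Inl (i, j)) = 0) \<and> (\<forall>i j. z (Inr (i, j)) = 0)"
    and "\<And>v. \<exists>z\<in>pair_space (block_act a) (block_act b). \<forall>i\<in>F. z i = v i"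
  shows "has_dim (pair_space (block_act a) (block_act b)) (card F)"
proof (rule has_dim_free_coords)
  show "is_subspace (pair_space (block_act a) (block_act b))"
    by (intro is_subspace_pair_space lin_pencil_block_act)
  show "z = (\<lambda>_. 0)" if "z \<in> pair_space (block_act a) (block_act b)" "\<And>i. i \<in> F \<Longrightarrow> z i = 0" for z
    using assms(2)[OF that] by (intro fun_sum_zeroI) auto
qed (use assms(1,3) in auto)

text \<open>The first matrix is a Hankel matrix that vanishes from the antidiagonal \<open>min r s\<close> on, so its first
  row up to that index is free.\<close>

lemma pair_nilpotent_Jinf:
  "has_dim (pair_space (block_act (Jfin r 0)) (block_act (Jinf s))) (min r s)"
proof -
  let ?F = "(\<lambda>j. Inl (0, j)) ` {..<min r s} :: (nat \<times> nat + nat \<times> nat) set"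
  have "has_dim (pair_space (block_act (Jfin r 0)) (block_act (Jinf s))) (card ?F)"
  proof (rule has_dim_pair_free_coords)
    fix z assume z: "z \<in> pair_space (block_act (Jfin r 0)) (block_act (Jinf s))"
      and F: "\<And>i. i \<in> ?F \<Longrightarrow> z i = 0"
    have supp: "\<not> (i < r \<and> j < s) \<Longrightarrow> z (Inl (i, j)) = 0"
      "\<not> (j < s \<and> i < r) \<Longrightarrow> z (Inr (j, i)) = 0"
      for i j
      using z unfolding pair_space_def by auto
    have eq: "z (Inl (Suc i, j)) + z (Inr (Suc j, i)) = 0" "z (Inr (j, i)) + z (Inl (i, j)) = 0"
      if "i < r" "j < s" for i j using z that unfolding pair_space_def by auto
    have step: "z (Inl (Suc i, j)) = z (Inl (i, Suc j))" if "i < r" for i j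
    proof (cases "j < s")
      case True
      then have "z (Inr (Suc j, i)) + z (Inl (i, Suc j)) = 0"
        using supp[of i "Suc j"] supp(2)[of "Suc j" i] eq(2)[of i "Suc j"] that by (cases "Suc j < s") auto
      then show ?thesis using eq(1)[OF that True] by (metis add.commute add_left_cancel)
    qed (use supp in auto)
    have hankel: "z (Inl (i, j)) = z (Inl (0, i + j))" if "i \<le> r" for i j
      using that by (induction i arbitrary: j) (auto simp: step)
    have "z (Inl (0, k)) = 0" for k
    proof -
      consider "k < min r s" | "k \<ge> s" | "k \<ge> r" by linarith
      then show ?thesis
      proof cases
        case 1 then show ?thesis using F by auto
      next
        case 2 then show ?thesis using supp by auto
      next
        case 3 then show ?thesis using hankel[of r "k - r"] supp(1)[of r "k - r"] by auto
      qed
    qed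
    then have c: "z (Inl (i, j)) = 0" for i j using hankel[of i j] supp(1)[of i j] by (cases "i \<le> r") auto
    have "z (Inr (j, i)) = 0" for i j using eq(2)[of i j] supp(2)[of j i] c by (cases "i < r \<and> j < s") auto
    then show "(\<forall>i j. z (Inl (i, j)) = 0) \<and> (\<forall>i j. z (Inr (i, j)) = 0)" using c by simp
  next
    fix v :: "nat \<times> nat + nat \<times> nat \<Rightarrow> complex"
    define c where "c i j = (if i + j < min r s then v (Inl (0, i + j)) else 0)" for i j
    define z where "z = case_sum (\<lambda>(i, j). c i j) (\<lambda>(j, i). - c i j)"
    have "z \<in> pair_space (block_act (Jfin r 0)) (block_act (Jinf s))"
      unfolding pair_space_def by (auto simp: z_def c_def)
    moreover have "\<forall>i\<in>?F. z i = v i" by (auto simp: z_def c_def)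
    ultimately show "\<exists>z\<in>pair_space (block_act (Jfin r 0)) (block_act (Jinf s)). \<forall>i\<in>?F. z i = v i" by blast
  qed simp
  moreover have "card ?F = min r s" by (subst card_image) (auto simp: inj_on_def)
  ultimately show ?thesis by simp
qed

text \<open>The last row of the second matrix is free.  The equations compute the remaining rows upwards from
  it by applying the Jordan block.\<close>

lemma pair_Jfin_L: "has_dim (pair_space (block_act (Jfin r l)) (block_act (Lblk s))) r"
proof -
  let ?F = "(\<lambda>i. Inr (s, i)) ` {..<r} :: (nat \<times> nat + nat \<times> nat) set"
  have "has_dim (pair_space (block_act (Jfin r l)) (block_act (Lblk s))) (card ?F)"
  proof (rule has_dim_pair_free_coords)
    fix z assume z: "z \<in> pair_space (block_act (Jfin r l)) (block_act (Lblk s))"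
      and F: "\<And>i. i \<in> ?F \<Longrightarrow> z i = 0"
    have supp: "\<not> (i < r \<and> j < s) \<Longrightarrow> z (Inl (i, j)) = 0"
      "\<not> (j < Suc s \<and> i < r) \<Longrightarrow> z (Inr (j, i)) = 0"
      for i j
      using z unfolding pair_space_def by auto
    have eq: "l * z (Inl (i, j)) + z (Inl (Suc i, j)) + z (Inr (j, i)) = 0"
      "z (Inr (Suc j, i)) + z (Inl (i, j)) = 0"
      if "i < r" "j < s" for i j using z that unfolding pair_space_def by auto
    have c: "z (Inl (i, j)) = 0" if "\<forall>i. z (Inr (Suc j, i)) = 0" for i j
      using eq(2)[of i j] supp(1)[of i j] that by (cases "i < r \<and> j < s") auto
    have d: "\<forall>i. z (Inr (s - k, i)) = 0" for k
    proof (induction k)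
      case 0
      have "z (Inr (s, i)) = 0" for i
        using F[of "Inr (s, i)"] supp(2)[of s i] by (cases "i < r") auto
      then show ?case by simp
    next
      case (Suc k)
      show ?case
      proof (cases "k < s")
        case True
        then have "s - k = Suc (s - Suc k)" by simp
        then have "z (Inl (i, s - Suc k)) = 0" for i using c Suc by simp
        then show ?thesis
          using eq(1)[of _ "s - Suc k"] supp(2)[of "s - Suc k"] True
          by (metis add.left_neutral add.right_neutral diff_Suc_less less_nat_zero_code
              mult_zero_right not_gr_zero)
      qed (use Suc in simp)
    qed
    have d': "z (Inr (j, i)) = 0" for i j using d[of "s - j"] supp(2)[of j i] by (cases "j \<le> s") auto
    then show "(\<forall>i j. z (Inl (i, j)) = 0) \<and> (\<forall>i j. z (Inr (i, j)) = 0)" using c by simp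
  next
    fix v :: "nat \<times> nat + nat \<times> nat \<Rightarrow> complex"
    define e where "e k = ((\<lambda>f i. l * f i + f (Suc i)) ^^ k) (\<lambda>i. if i < r then v (Inr (s, i)) else 0)" for k
    have e0: "e 0 i = (if i < r then v (Inr (s, i)) else 0)" for i by (simp add: e_def)
    have eS: "e (Suc k) i = l * e k i + e k (Suc i)" for k i by (simp add: e_def)
    have er: "i \<ge> r \<Longrightarrow> e k i = 0" for k i by (induction k arbitrary: i) (auto simp: e0 eS)
    define z where "z = case_sum (\<lambda>(i, j). if j < s then - e (s - Suc j) i else 0)
      (\<lambda>(j, i). if j \<le> s then e (s - j) i else 0)"
    have "e (s - j) i = l * e (s - Suc j) i + e (s - Suc j) (Suc i)" if "j < s" for i j
      using eS[of "s - Suc j" i] that by (simp add: Suc_diff_Suc)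
    then have "z \<in> pair_space (block_act (Jfin r l)) (block_act (Lblk s))"
      unfolding pair_space_def by (auto simp: z_def er)
    moreover have "\<forall>i\<in>?F. z i = v i" by (auto simp: z_def e0)
    ultimately show "\<exists>z\<in>pair_space (block_act (Jfin r l)) (block_act (Lblk s)). \<forall>i\<in>?F. z i = v i" by blast
  qed simp
  moreover have "card ?F = r" by (subst card_image) (auto simp: inj_on_def)
  ultimately show ?thesis by simp
qed

text \<open>The first row of the second matrix is free, and the following rows are its shifts.\<close>

lemma pair_Jinf_L: "has_dim (pair_space (block_act (Jinf r)) (block_act (Lblk s))) r"
proof -
  let ?F = "(\<lambda>i. Inr (0, i)) ` {..<r} :: (nat \<times> nat + nat \<times> nat) set"
  have "has_dim (pair_space (block_act (Jinf r)) (block_act (Lblk s))) (card ?F)"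
  proof (rule has_dim_pair_free_coords)
    fix z assume z: "z \<in> pair_space (block_act (Jinf r)) (block_act (Lblk s))"
      and F: "\<And>i. i \<in> ?F \<Longrightarrow> z i = 0"
    have supp: "\<not> (i < r \<and> j < s) \<Longrightarrow> z (Inl (i, j)) = 0"
      "\<not> (j < Suc s \<and> i < r) \<Longrightarrow> z (Inr (j, i)) = 0"
      for i j
      using z unfolding pair_space_def by auto
    have eq: "z (Inl (i, j)) + z (Inr (j, i)) = 0" "z (Inr (Suc j, i)) + z (Inl (Suc i, j)) = 0"
      if "i < r" "j < s" for i j using z that unfolding pair_space_def by auto
    have c: "z (Inl (i, j)) = 0" if "\<forall>i. z (Inr (j, i)) = 0" for i j
      using eq(1)[of i j] supp(1)[of i j] that by (cases "i < r \<and> j < s") auto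
    have d: "\<forall>i. z (Inr (j, i)) = 0" for j
    proof (induction j)
      case 0
      have "z (Inr (0, i)) = 0" for i
        using F[of "Inr (0, i)"] supp(2)[of 0 i] by (cases "i < r") auto
      then show ?case by simp
    next
      case (Suc j)
      have "z (Inr (Suc j, i)) = 0" for i
        using c[OF Suc, of "Suc i"] eq(2)[of i j] supp(2)[of "Suc j" i] by (cases "i < r \<and> j < s") auto
      then show ?case by simp
    qed
    then show "(\<forall>i j. z (Inl (i, j)) = 0) \<and> (\<forall>i j. z (Inr (i, j)) = 0)" using c by simp
  next
    fix v :: "nat \<times> nat + nat \<times> nat \<Rightarrow> complex"
    define d where "d j i = (if j \<le> s \<and> i + j < r then v (Inr (0, i + j)) else 0)" for j i
    define z where "z = case_sum (\<lambda>(i, j). if j < s then - d j i else 0) (\<lambda>(j, i). d j i)"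
    have "z \<in> pair_space (block_act (Jinf r)) (block_act (Lblk s))"
      unfolding pair_space_def by (auto simp: z_def d_def)
    moreover have "\<forall>i\<in>?F. z i = v i" by (auto simp: z_def d_def)
    ultimately show "\<exists>z\<in>pair_space (block_act (Jinf r)) (block_act (Lblk s)). \<forall>i\<in>?F. z i = v i" by blast
  qed simp
  moreover have "card ?F = r" by (subst card_image) (auto simp: inj_on_def)
  ultimately show ?thesis by simp
qed

text \<open>An entry of one matrix equals the negative of an entry of the other matrix on the previous
  antidiagonal.  Following these links ends in one of the two first rows, which are free.\<close>

lemma pair_L_L: "has_dim (pair_space (block_act (Lblk r)) (block_act (Lblk s))) (r + s)"
proof -
  let ?F1 = "(\<lambda>j. Inl (0, j)) ` {..<s} :: (nat \<times> nat + nat \<times> nat) set"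
  let ?F2 = "(\<lambda>i. Inr (0, i)) ` {..<r} :: (nat \<times> nat + nat \<times> nat) set"
  have "has_dim (pair_space (block_act (Lblk r)) (block_act (Lblk s))) (card (?F1 \<union> ?F2))"
  proof (rule has_dim_pair_free_coords)
    fix z assume z: "z \<in> pair_space (block_act (Lblk r)) (block_act (Lblk s))"
      and F: "\<And>i. i \<in> ?F1 \<union> ?F2 \<Longrightarrow> z i = 0"
    have supp: "\<not> (i < Suc r \<and> j < s) \<Longrightarrow> z (Inl (i, j)) = 0"
      "\<not> (j < Suc s \<and> i < r) \<Longrightarrow> z (Inr (j, i)) = 0"
      for i j
      using z unfolding pair_space_def by auto
    have eq: "z (Inl (Suc i, j)) + z (Inr (j, i)) = 0" "z (Inr (Suc j, i)) + z (Inl (i, j)) = 0"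
      if "i < r" "j < s" for i j using z that unfolding pair_space_def by auto
    have f: "z (Inl (0, j)) = 0" "z (Inr (0, i)) = 0" for i j
      using F supp(1)[of 0 j] supp(2)[of 0 i] by (cases "j < s"; cases "i < r"; auto)+
    have "\<forall>i j. i + j = k \<longrightarrow> z (Inl (i, j)) = 0 \<and> z (Inr (j, i)) = 0" for k
    proof (induction k)
      case 0
      then show ?case using f by simp
    next
      case (Suc k)
      show ?case
      proof (intro allI impI conjI)
        fix i j assume ij: "i + j = Suc k"
        show "z (Inl (i, j)) = 0"
        proof (cases i)
          case (Suc i')
          then have "z (Inr (j, i')) = 0" using Suc.IH ij by simp
          then show ?thesis using eq(1)[of i' j] supp(1)[of i j] Suc by (cases "i' < r \<and> j < s") auto
        qed (simp add: f)
        show "z (Inr (j, i)) = 0"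
        proof (cases j)
          case (Suc j')
          then have "z (Inl (i, j')) = 0" using Suc.IH ij by simp
          then show ?thesis using eq(2)[of i j'] supp(2)[of j i] Suc by (cases "i < r \<and> j' < s") auto
        qed (simp add: f)
      qed
    qed
    then show "(\<forall>i j. z (Inl (i, j)) = 0) \<and> (\<forall>i j. z (Inr (i, j)) = 0)" by simp
  next
    fix v :: "nat \<times> nat + nat \<times> nat \<Rightarrow> complex"
    define z where "z = case_sum
      (\<lambda>(i, j). if i < Suc r \<and> j < s then (if i \<le> j then v (Inl (0, j - i)) else - v (Inr (0, i - Suc j))) else 0)
      (\<lambda>(j, i). if j < Suc s \<and> i < r then (if j \<le> i then v (Inr (0, i - j)) else - v (Inl (0, j - Suc i))) else 0)"
    have "z \<in> pair_space (block_act (Lblk r)) (block_act (Lblk s))"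
      unfolding pair_space_def by (auto simp: z_def)
    moreover have "\<forall>i\<in>?F1 \<union> ?F2. z i = v i" by (auto simp: z_def)
    ultimately show "\<exists>z\<in>pair_space (block_act (Lblk r)) (block_act (Lblk s)). \<forall>i\<in>?F1 \<union> ?F2. z i = v i" by blast
  qed simp
  moreover have "card ?F1 = s" "card ?F2 = r" by (subst card_image; auto simp: inj_on_def)+
  moreover have "card (?F1 \<union> ?F2) = card ?F1 + card ?F2" by (rule card_Un_disjoint) auto
  ultimately show ?thesis by (simp add: add.commute)
qed

text \<open>The first matrix is an \<open>(r + 1) \<times> (s + 1)\<close> Hankel matrix whose first column above the last row and
  whose last column below the first row vanish, so only the antidiagonals from \<open>r\<close> to \<open>s\<close> survive.
  All of them meet the last row.\<close>

lemma pair_L_LT: "has_dim (pair_space (block_act (Lblk r)) (block_act (LTblk s))) (Suc s - r)"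
proof -
  let ?F = "(\<lambda>j. Inl (r, j)) ` {..<Suc s - r} :: (nat \<times> nat + nat \<times> nat) set"
  have "has_dim (pair_space (block_act (Lblk r)) (block_act (LTblk s))) (card ?F)"
  proof (rule has_dim_pair_free_coords)
    fix z assume z: "z \<in> pair_space (block_act (Lblk r)) (block_act (LTblk s))"
      and F: "\<And>i. i \<in> ?F \<Longrightarrow> z i = 0"
    have supp: "\<not> (i < Suc r \<and> j < Suc s) \<Longrightarrow> z (Inl (i, j)) = 0"
      "\<not> (j < s \<and> i < r) \<Longrightarrow> z (Inr (j, i)) = 0"
      for i j
      using z unfolding pair_space_def by auto
    have eq: "z (Inl (Suc i, j)) + z (Inr (j, i)) = 0"
      "(if j = 0 then 0 else z (Inr (j - 1, i))) + z (Inl (i, j)) = 0"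
      if "i < r" "j < Suc s" for i j using z that unfolding pair_space_def by auto
    have step: "z (Inl (Suc i, j)) = z (Inl (i, Suc j))" if "i < r" "j < s" for i j
      using eq(1)[of i j] eq(2)[of i "Suc j"] that by (simp add: eq_neg_iff_add_eq_0 [symmetric])
    have right: "z (Inl (Suc i, s)) = 0" for i
      using eq(1)[of i s] supp(1)[of "Suc i" s] supp(2)[of s i] by (cases "i < r") auto
    have left: "z (Inl (i, 0)) = 0" if "i < r" for i using eq(2)[of i 0] that by simp
    have high: "\<forall>i. i + (s - k) > s \<longrightarrow> z (Inl (i, s - k)) = 0" for k
    proof (induction k)
      case 0
      then show ?case using right by (auto simp: gr0_conv_Suc)
    next
      case (Suc k)
      show ?case
      proof (cases "k < s")
        case True
        then have sk: "s - k = Suc (s - Suc k)" by simp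
        show ?thesis
        proof (intro allI impI)
          fix i assume i: "i + (s - Suc k) > s"
          then obtain i' where i': "i = Suc i'" by (cases i) auto
          have "z (Inl (i', s - k)) = 0" using Suc i i' sk by simp
          then show "z (Inl (i, s - Suc k)) = 0"
            using step[of i' "s - Suc k"] supp(1)[of i "s - Suc k"] i' sk True by (cases "i' < r") auto
        qed
      qed (use Suc in simp)
    qed
    have high': "z (Inl (i, j)) = 0" if "i + j > s" for i j
      using high[of "s - j"] supp(1)[of i j] that by (cases "j \<le> s") auto
    have bottom: "z (Inl (r, j)) = 0" for j
      using F[of "Inl (r, j)"] high'[of r j] by (cases "r + j \<le> s") auto
    have c: "\<forall>j. z (Inl (r - k, j)) = 0" for k
    proof (induction k)
      case 0
      then show ?case using bottom by simp
    next
      case (Suc k)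
      show ?case
      proof (cases "k < r")
        case True
        then have rk: "r - k = Suc (r - Suc k)" by simp
        have "z (Inl (r - Suc k, j)) = 0" for j
          using left[of "r - Suc k"] step[of "r - Suc k" "j - 1"] supp(1)[of _ j] Suc rk True
          by (cases j; cases "j \<le> s") auto
        then show ?thesis by simp
      qed (use Suc in simp)
    qed
    have c': "z (Inl (i, j)) = 0" for i j using c[of "r - i"] supp(1)[of i j] by (cases "i \<le> r") auto
    have "z (Inr (j, i)) = 0" for i j using eq(1)[of i j] supp(2)[of j i] c' by (cases "i < r \<and> j < s") auto
    then show "(\<forall>i j. z (Inl (i, j)) = 0) \<and> (\<forall>i j. z (Inr (i, j)) = 0)" using c' by simp
  next
    fix v :: "nat \<times> nat + nat \<times> nat \<Rightarrow> complex"
    define c where "c i j = (if i \<le> r \<and> r \<le> i + j \<and> i + j \<le> s then v (Inl (r, i + j - r)) else 0)" for i j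
    define z where "z = case_sum (\<lambda>(i, j). c i j) (\<lambda>(j, i). - c (Suc i) j)"
    have "z \<in> pair_space (block_act (Lblk r)) (block_act (LTblk s))"
      unfolding pair_space_def by (auto simp: z_def c_def)
    moreover have "\<forall>i\<in>?F. z i = v i" by (auto simp: z_def c_def)
    ultimately show "\<exists>z\<in>pair_space (block_act (Lblk r)) (block_act (LTblk s)). \<forall>i\<in>?F. z i = v i" by blast
  qed simp
  moreover have "card ?F = Suc s - r" by (subst card_image) (auto simp: inj_on_def)
  ultimately show ?thesis by simp
qed

text \<open>Eliminating the second matrix leaves \<open>v c (i + 1) j + l c i (j + 1) + c (i + 1) (j + 1) = 0\<close>.
  Solved for \<open>c (i + 1) j\<close> it computes each row from the preceding one; read from the last row
  upwards it shows that the antidiagonals from \<open>r\<close> on vanish.\<close>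

lemma pair_Jfin_Jfin_facts:
  assumes lv: "l * v = 1"
    and z: "z \<in> pair_space (block_act (Jfin r l)) (block_act (Jfin s v))"
  shows "i < r \<Longrightarrow> z (Inl (Suc i, j)) = - (l * (l * z (Inl (i, Suc j)) + z (Inl (Suc i, Suc j))))"
    and "z (Inr (j, i)) = - (l * z (Inl (i, j)) + z (Inl (Suc i, j)))"
    and "r \<le> i + j \<Longrightarrow> z (Inl (i, j)) = 0"
proof -
  have supp: "\<not> (i < r \<and> j < s) \<Longrightarrow> z (Inl (i, j)) = 0"
    "\<not> (j < s \<and> i < r) \<Longrightarrow> z (Inr (j, i)) = 0"
    for i j
    using z unfolding pair_space_def by auto
  have eq: "l * z (Inl (i, j)) + z (Inl (Suc i, j)) + z (Inr (j, i)) = 0"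
    "v * z (Inr (j, i)) + z (Inr (Suc j, i)) + z (Inl (i, j)) = 0"
    if "i < r" "j < s" for i j using z that unfolding pair_space_def by auto
  show d: "z (Inr (j, i)) = - (l * z (Inl (i, j)) + z (Inl (Suc i, j)))" for i j
  proof (cases "i < r \<and> j < s")
    case True
    then show ?thesis using eq(1)[of i j] unfolding add_eq_0_iff by blast
  next
    case False
    then have "z (Inl (i, j)) = 0" "z (Inl (Suc i, j)) = 0" "z (Inr (j, i)) = 0"
      using supp(1)[of i j] supp(1)[of "Suc i" j] supp(2)[of j i] by auto
    then show ?thesis by simp
  qed
  have vl: "v * l = 1" using lv by (simp add: mult.commute)
  have rec: "v * z (Inl (Suc i, j)) + l * z (Inl (i, Suc j)) + z (Inl (Suc i, Suc j)) = 0"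
    if "i < r" for i j
  proof (cases "j < s")
    case True
    have "v * z (Inl (Suc i, j)) + l * z (Inl (i, Suc j)) + z (Inl (Suc i, Suc j))
        = - (v * z (Inr (j, i)) + z (Inr (Suc j, i)) + (v * l) * z (Inl (i, j)))"
      unfolding d by (simp add: algebra_simps)
    then show ?thesis using eq(2)[OF that True] by (simp add: vl)
  qed (use supp in auto)
  show "i < r \<Longrightarrow> z (Inl (Suc i, j)) = - (l * (l * z (Inl (i, Suc j)) + z (Inl (Suc i, Suc j))))" for i j
  proof -
    assume "i < r"
    have "z (Inl (Suc i, j)) + l * (l * z (Inl (i, Suc j)) + z (Inl (Suc i, Suc j)))
       = l * (v * z (Inl (Suc i, j)) + l * z (Inl (i, Suc j)) + z (Inl (Suc i, Suc j)))"
      using lv by (simp add: distrib_left mult.assoc[symmetric])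
    then show ?thesis using rec[OF \<open>i < r\<close>] by (simp add: eq_neg_iff_add_eq_0)
  qed
  have anti: "\<forall>j\<ge>k. z (Inl (r - k, j)) = 0" if "k \<le> r" for k
    using that
  proof (induction k)
    case 0
    then show ?case using supp by simp
  next
    case (Suc k)
    then have rk: "r - k = Suc (r - Suc k)" by simp
    show ?case
    proof (intro allI impI)
      fix j assume "j \<ge> Suc k"
      then obtain j' where j': "j = Suc j'" "j' \<ge> k" by (cases j) auto
      have "l * z (Inl (r - Suc k, j)) = 0"
        using rec[of "r - Suc k" j'] Suc j' rk by simp
      then show "z (Inl (r - Suc k, j)) = 0" using lv by auto
    qed
  qed
  show "r \<le> i + j \<Longrightarrow> z (Inl (i, j)) = 0" for i j
    using anti[of "r - i"] supp(1)[of i j] by (cases "i \<le> r") auto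
qed

text \<open>The row recursion never uses an earlier antidiagonal, so zeros at the end of the first row extend
  to the corresponding antidiagonals.\<close>

lemma pair_Jfin_Jfin_leading_zero:
  assumes lv: "l * v = 1"
    and z: "z \<in> pair_space (block_act (Jfin r l)) (block_act (Jfin s v))"
    and top: "\<And>j. m \<le> j \<Longrightarrow> j < min r s \<Longrightarrow> z (Inl (0, j)) = 0"
  shows "m \<le> i + j \<Longrightarrow> z (Inl (i, j)) = 0"
proof -
  note facts = pair_Jfin_Jfin_facts[OF lv z]
  have supp: "\<not> (i < r \<and> j < s) \<Longrightarrow> z (Inl (i, j)) = 0" for i j
    using z unfolding pair_space_def by auto
  have "\<forall>j. m \<le> i + j \<longrightarrow> z (Inl (i, j)) = 0" for i
  proof (induction i)
    case 0
    show ?case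
    proof (intro allI impI)
      fix j assume "m \<le> 0 + j"
      then show "z (Inl (0, j)) = 0"
        using top[of j] supp[of 0 j] facts(3)[of 0 j] by (cases "j < r"; cases "j < s") auto
    qed
  next
    case (Suc i)
    show ?case
    proof (cases "i < r")
      case True
      have "m \<le> Suc i + j \<longrightarrow> z (Inl (Suc i, j)) = 0" for j
      proof (induction "s - j" arbitrary: j rule: less_induct)
        case less
        show ?case
        proof (cases "j < s")
          case True
          then have "s - Suc j < s - j" by simp
          then have "m \<le> Suc i + Suc j \<longrightarrow> z (Inl (Suc i, Suc j)) = 0" by (rule less)
          then show ?thesis using facts(1)[OF \<open>i < r\<close>, of j] Suc by simp
        qed (use supp in auto)
      qed
      then show ?thesis by blast
    qed (use supp in auto)
  qed
  then show "m \<le> i + j \<Longrightarrow> z (Inl (i, j)) = 0" by blast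
qed

text \<open>The solution of the row recursion with first row \<open>v\<close>, supported on the antidiagonals below \<open>m\<close>.
  The recursion uses later entries of the same row; it terminates because of the cut-off at \<open>m\<close>.\<close>

function triangular_solution :: "complex \<Rightarrow> nat \<Rightarrow> (nat \<Rightarrow> complex) \<Rightarrow> nat \<Rightarrow> nat \<Rightarrow> complex" where
  "triangular_solution l m v 0 j = (if j < m then v j else 0)"
| "triangular_solution l m v (Suc i) j = (if Suc i + j < m
     then - (l * (l * triangular_solution l m v i (Suc j) + triangular_solution l m v (Suc i) (Suc j))) else 0)"
  by pat_completeness auto
termination
  by (relation "measures [\<lambda>(l, m, v, i, j). i, \<lambda>(l, m, v, i, j). m - j]") auto

declare triangular_solution.simps(2)[simp del]

lemma triangular_solution_zero: "m \<le> i + j \<Longrightarrow> triangular_solution l m v i j = 0"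
  by (cases i) (auto simp: triangular_solution.simps(2))

lemma triangular_solution_rec:
  "triangular_solution l m v (Suc i) j = - (l * (l * triangular_solution l m v i (Suc j) + triangular_solution l m v (Suc i) (Suc j)))"
proof (cases "Suc i + j < m")
  case False
  then show ?thesis using triangular_solution_zero[of m "Suc i" j] triangular_solution_zero[of m i "Suc j"] triangular_solution_zero[of m "Suc i" "Suc j"]
    by simp
qed (simp add: triangular_solution.simps(2))

text \<open>The first \<open>min r s\<close> entries of the first row are free: the remaining ones vanish, and the row
  recursion yields the rest.\<close>

lemma pair_Jfin_Jfin:
  assumes lv: "l * v = 1"
  shows "has_dim (pair_space (block_act (Jfin r l)) (block_act (Jfin s v))) (min r s)"
proof -
  let ?F = "(\<lambda>j. Inl (0, j)) ` {..<min r s} :: (nat \<times> nat + nat \<times> nat) set"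
  have "has_dim (pair_space (block_act (Jfin r l)) (block_act (Jfin s v))) (card ?F)"
  proof (rule has_dim_pair_free_coords)
    fix z assume z: "z \<in> pair_space (block_act (Jfin r l)) (block_act (Jfin s v))"
      and F: "\<And>i. i \<in> ?F \<Longrightarrow> z i = 0"
    have c: "z (Inl (i, j)) = 0" for i j
      by (rule pair_Jfin_Jfin_leading_zero[OF lv z, of 0]) (use F in auto)
    then show "(\<forall>i j. z (Inl (i, j)) = 0) \<and> (\<forall>i j. z (Inr (i, j)) = 0)"
      using pair_Jfin_Jfin_facts(2)[OF lv z] by simp
  next
    fix w :: "nat \<times> nat + nat \<times> nat \<Rightarrow> complex"
    define c where "c = triangular_solution l (min r s) (\<lambda>j. w (Inl (0, j)))"
    define z where "z = case_sum (\<lambda>(i, j). c i j) (\<lambda>(j, i). - (l * c i j + c (Suc i) j))"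
    have c0: "c i j = 0" if "min r s \<le> i + j" for i j unfolding c_def using that by (rule triangular_solution_zero)
    have vl: "v * l = 1" using lv by (simp add: mult.commute)
    have vc: "v * c (Suc i) j = - (l * c i (Suc j) + c (Suc i) (Suc j))" for i j
    proof -
      have "v * c (Suc i) j = - ((v * l) * (l * c i (Suc j) + c (Suc i) (Suc j)))"
        unfolding c_def by (subst triangular_solution_rec) (simp add: algebra_simps)
      then show ?thesis by (simp add: vl)
    qed
    have "v * - (l * c i j + c (Suc i) j) + - (l * c i (Suc j) + c (Suc i) (Suc j)) + c i j = 0" for i j
    proof -
      have "v * - (l * c i j + c (Suc i) j) = - (v * l) * c i j - v * c (Suc i) j"
        by (simp add: algebra_simps)
      then show ?thesis by (simp add: vl vc)
    qed
    then have "z \<in> pair_space (block_act (Jfin r l)) (block_act (Jfin s v))"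
      unfolding pair_space_def by (auto simp: z_def c0)
    moreover have "\<forall>i\<in>?F. z i = w i" by (auto simp: z_def c_def)
    ultimately show "\<exists>z\<in>pair_space (block_act (Jfin r l)) (block_act (Jfin s v)). \<forall>i\<in>?F. z i = w i" by blast
  qed simp
  moreover have "card ?F = min r s" by (subst card_image) (auto simp: inj_on_def)
  ultimately show ?thesis by simp
qed

section \<open>Single Kronecker blocks\<close>

text \<open>The link \<open>c (i + 1) j = - c j i\<close> leads from each entry to one in the first row.\<close>

lemma self_L: "has_dim (self_space (block_act (Lblk r))) r"
proof -
  let ?F = "(\<lambda>j. (0, j)) ` {..<r} :: (nat \<times> nat) set"
  have "has_dim (self_space (block_act (Lblk r))) (card ?F)"
  proof (rule has_dim_free_coords)
    show "is_subspace (self_space (block_act (Lblk r)))"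
      by (intro is_subspace_self_space lin_pencil_block_act)
    fix x assume x: "x \<in> self_space (block_act (Lblk r))" and F: "\<And>i. i \<in> ?F \<Longrightarrow> x i = 0"
    have supp: "\<not> (i < Suc r \<and> j < r) \<Longrightarrow> x (i, j) = 0" for i j
      using x unfolding self_space_def by auto
    have eq: "x (Suc i, j) + x (j, i) = 0" if "i < r" "j < r" for i j
      using x that unfolding self_space_def by auto
    have "\<forall>i j. i + j = k \<longrightarrow> x (i, j) = 0" for k
    proof (induction k)
      case 0
      show ?case using F supp[of 0 0] by (cases "0 < r") auto
    next
      case (Suc k)
      show ?case
      proof (intro allI impI)
        fix i j assume ij: "i + j = Suc k"
        show "x (i, j) = 0"
        proof (cases i)
          case 0
          then show ?thesis using F supp[of 0 j] by (cases "j < r") auto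
        next
          case (Suc i')
          then have "x (j, i') = 0" using Suc.IH ij by simp
          then show ?thesis using eq[of i' j] supp[of i j] Suc by (cases "i' < r \<and> j < r") auto
        qed
      qed
    qed
    then show "x = (\<lambda>_. 0)" by (auto simp: fun_eq_iff)
  next
    fix v :: "nat \<times> nat \<Rightarrow> complex"
    define x where "x = (\<lambda>(i, j). if i < Suc r \<and> j < r
      then (if i \<le> j then v (0, j - i) else - v (0, i - Suc j)) else 0)"
    have "x \<in> self_space (block_act (Lblk r))"
      unfolding self_space_def by (auto simp: x_def)
    moreover have "\<forall>i\<in>?F. x i = v i" by (auto simp: x_def)
    ultimately show "\<exists>x\<in>self_space (block_act (Lblk r)). \<forall>i\<in>?F. x i = v i" by blast
  qed simp
  moreover have "card ?F = r" by (subst card_image) (auto simp: inj_on_def)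
  ultimately show ?thesis by simp
qed

text \<open>The equation for a single pencil is the diagonal case of the equations for a pair.\<close>

lemma case_sum_self_space: "x \<in> self_space A \<Longrightarrow> case_sum x x \<in> pair_space A A"
  by (auto simp: self_space_def pair_space_def)

lemma has_dim_self_trivial:
  assumes "lin_pencil A" "has_dim (pair_space A A) 0"
  shows "has_dim (self_space A) 0"
proof -
  obtain \<psi> where b: "bij_betw \<psi> (pair_space A A) (coord_space 0)"
    using assms(2) unfolding has_dim_def by blast
  have 0: "(\<lambda>_. 0) \<in> pair_space A A" using assms(2) by (auto simp: has_dim_def is_subspace_def)
  have "z = (\<lambda>_. 0)" if "z \<in> pair_space A A" for z
    using inj_onD[OF bij_betw_imp_inj_on[OF b] _ that 0] bij_betwE[OF b] that 0
    by (auto simp: coord_space_def fun_eq_iff)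
  then have "case_sum x x = (\<lambda>_. 0)" if "x \<in> self_space A" for x
    using case_sum_self_space that by blast
  then have "x = (\<lambda>_. 0)" if "x \<in> self_space A" for x
    using fun_cong[of "case_sum x x" _ "Inl _"] that by (metis old.sum.simps(5) ext)
  then have "self_space A = {\<lambda>_. 0}"
    using is_subspace_self_space[OF assms(1)] unfolding is_subspace_def by blast
  then show ?thesis using has_dim_zero by simp
qed

text \<open>A solution is determined by its first row, and the last nonzero entry of that row, in column
  \<open>k\<close>, must satisfy \<open>(-1)\<^sup>k = -e\<close>.  Conversely, averaging a solution of \<open>J C J\<^sup>T = C\<close> over the involution
  \<open>C \<mapsto> -(J C)\<^sup>T\<close> produces a fixed point for each such \<open>k\<close>.\<close>

lemma self_Jfin_square_one:
  assumes e: "e * e = 1"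
  shows "has_dim (self_space (block_act (Jfin r e))) (card ({k. (-1) ^ k = - e} \<inter> {..<r}))"
proof (rule has_dim_echelon[where i = "\<lambda>k. (0, k)"])
  let ?W = "self_space (block_act (Jfin r e))"
  show "is_subspace ?W" by (intro is_subspace_self_space lin_pencil_block_act)
  have lead: "x (i, j) = 0"
    if "x \<in> ?W" "\<And>j. m \<le> j \<Longrightarrow> j < r \<Longrightarrow> x (0, j) = 0" "m \<le> i + j" for x m i j
    using pair_Jfin_Jfin_leading_zero[OF e case_sum_self_space[OF that(1)], of m i j] that(2,3) by simp
  show "x = (\<lambda>_. 0)" if "x \<in> ?W" "\<And>k. k < r \<Longrightarrow> x (0, k) = 0" for x
    using lead[OF that(1), of 0] that(2) by (auto simp: fun_eq_iff)
  show "x (0, k) = 0" if k: "k < r" "k \<notin> {k. (-1) ^ k = - e}" and x: "x \<in> ?W"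
    and z: "\<And>l. k < l \<Longrightarrow> l < r \<Longrightarrow> x (0, l) = 0" for k x
  proof -
    have high: "x (i, j) = 0" if "Suc k \<le> i + j" for i j
      by (rule lead[OF x _ that]) (use z in auto)
    \<comment> \<open>On the last nonzero antidiagonal the recursion reduces to \<open>x (i + 1, j) = - x (i, j + 1)\<close>.\<close>
    have ik: "i \<le> k \<Longrightarrow> x (i, k - i) = (-1) ^ i * x (0, k)" for i
    proof (induction i)
      case (Suc i)
      then have "k - i = Suc (k - Suc i)" by simp
      moreover have "x (Suc i, k - Suc i) = - (e * e * x (i, Suc (k - Suc i)) + e * x (Suc i, Suc (k - Suc i)))"
        using pair_Jfin_Jfin_facts(1)[OF e case_sum_self_space[OF x], of i "k - Suc i"] Suc k
        by (simp add: algebra_simps)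
      ultimately show ?case using Suc high[of "Suc i" "Suc (k - Suc i)"] by (simp add: e)
    qed simp
    have "e * x (0, k) + x (1, k) + x (k, 0) = 0"
      using x k unfolding self_space_def by auto
    then have "(e + (-1) ^ k) * x (0, k) = 0"
      using ik[of k] high[of 1 k] by (simp add: algebra_simps)
    moreover have "e + (-1) ^ k \<noteq> 0" using k by (simp add: add_eq_0_iff)
    ultimately show ?thesis by simp
  qed
  show "\<exists>w\<in>?W. w (0, k) = 1 \<and> (\<forall>l. k < l \<and> l < r \<longrightarrow> w (0, l) = 0)"
    if k: "k < r" "k \<in> {k. (-1) ^ k = - e}" for k
  proof -
    define c where "c = triangular_solution e (Suc k) (\<lambda>j. if j = k then 1 else 0)"
    define d where "d i j = - (e * c j i + c (Suc j) i)" for i j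
    define w where "w = (\<lambda>(i, j). (c i j + d i j) / 2)"
    have c0: "c i j = 0" if "Suc k \<le> i + j" for i j unfolding c_def using that by (rule triangular_solution_zero)
    have d0: "d i j = 0" if "Suc k \<le> i + j" for i j using that by (simp add: d_def c0)
    have rec: "e * c (Suc i) j = - (e * c i (Suc j) + c (Suc i) (Suc j))" for i j
    proof -
      have "e * c (Suc i) j = - ((e * e) * (e * c i (Suc j) + c (Suc i) (Suc j)))"
        unfolding c_def by (subst triangular_solution_rec) (simp add: algebra_simps)
      then show ?thesis by (simp add: e)
    qed
    \<comment> \<open>The map \<open>c \<mapsto> d\<close> is an involution on the solutions of the recursion.\<close>
    have dd: "e * d i j + d (Suc i) j = - c j i" for i j
    proof -
      have "e * d i j + d (Suc i) j = - (e * e) * c j i - e * c (Suc j) i - (e * c j (Suc i) + c (Suc j) (Suc i))"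
        by (simp add: d_def algebra_simps)
      then show ?thesis by (simp add: e rec)
    qed
    have "w \<in> ?W"
      unfolding self_space_def
    proof (intro CollectI conjI allI impI)
      fix i j assume "\<not> (i < ncols (block_act (Jfin r e)) \<and> j < nrows (block_act (Jfin r e)))"
      then have "Suc k \<le> i + j" using k by auto
      then show "w (i, j) = 0" by (simp add: w_def c0 d0)
    next
      fix i j
      have "e * w (i, j) + w (Suc i, j) + w (j, i)
          = ((e * c i j + c (Suc i) j + d j i) + (e * d i j + d (Suc i) j + c j i)) / 2"
        by (simp add: w_def algebra_simps add_divide_distrib)
      also have "\<dots> = 0" unfolding dd by (simp add: d_def)
      finally show "act0 (block_act (Jfin r e)) (\<lambda>k. w (k, j)) i
          + act1 (block_act (Jfin r e)) (\<lambda>k. w (k, i)) j = 0" by simp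
    qed
    moreover have "w (0, l) = 0" if "k < l" for l using that by (simp add: w_def c0 d0)
    moreover have "w (0, k) = 1"
    proof -
      have ik: "i \<le> k \<Longrightarrow> c i (k - i) = (-1) ^ i" for i
      proof (induction i)
        case 0
        show ?case by (simp add: c_def)
      next
        case (Suc i)
        then have ki: "Suc (k - Suc i) = k - i" by simp
        have "c (Suc i) (k - Suc i) = - (e * e * c i (Suc (k - Suc i)) + e * c (Suc i) (Suc (k - Suc i)))"
          unfolding c_def by (subst triangular_solution_rec) (simp add: algebra_simps)
        then show ?case using Suc c0[of "Suc i" "Suc (k - Suc i)"] by (simp add: e ki)
      qed
      have "c 0 k = 1" using ik[of 0] by simp
      moreover have "d 0 k = 1" using ik[of k] k c0[of "Suc k" 0] by (simp add: d_def e)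
      ultimately show ?thesis by (simp add: w_def)
    qed
    ultimately show ?thesis by blast
  qed
qed

lemma card_odd_below: "card ({k. odd k} \<inter> {..<r}) = r div 2"
  and card_even_below: "card ({k. even k} \<inter> {..<r}) = (r + 1) div 2"
proof (induction r)
  case (Suc r)
  {
    case 1
    have "{k. odd k} \<inter> {..<Suc r} = (if odd r then insert r ({k. odd k} \<inter> {..<r}) else {k. odd k} \<inter> {..<r})"
      by (auto simp: less_Suc_eq)
    then show ?case using Suc by (auto elim: oddE)
  next
    case 2
    have "{k. even k} \<inter> {..<Suc r} = (if even r then insert r ({k. even k} \<inter> {..<r}) else {k. even k} \<inter> {..<r})"
      by (auto simp: less_Suc_eq)
    then show ?case using Suc by (auto elim: oddE)
  }
qed simp_all

lemma self_Jfin: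
  "has_dim (self_space (block_act (Jfin r l)))
     (if l = 1 then r div 2 else if l = -1 then (r + 1) div 2 else 0)"
proof -
  have p: "{k. (-1::complex) ^ k = - 1} = {k. odd k}" "{k. (-1::complex) ^ k = 1} = {k. even k}"
    by (auto simp: minus_one_power_iff split: if_splits)
  have "l * l \<noteq> 1" if "l \<noteq> 1" "l \<noteq> -1"
  proof
    assume "l * l = 1"
    then have "(l - 1) * (l + 1) = 0" by (simp add: algebra_simps)
    then show False using that by (auto simp: eq_neg_iff_add_eq_0)
  qed
  then show ?thesis
    using self_Jfin_square_one[of 1 r] self_Jfin_square_one[of "-1" r]
      has_dim_self_trivial[OF lin_pencil_block_act pair_Jfin_Jfin_trivial[of l l r r]]
    by (auto simp: p card_odd_below card_even_below)
qed

section \<open>The dimension for a direct sum of Kronecker blocks\<close>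

fun self_count :: "kronecker_block \<Rightarrow> nat" where
  "self_count (Jfin r l) = (if l = 1 then r div 2 else if l = -1 then (r + 1) div 2 else 0)"
| "self_count (Jinf r) = 0"
| "self_count (Lblk r) = r"
| "self_count (LTblk r) = 0"

fun pair_count :: "kronecker_block \<Rightarrow> kronecker_block \<Rightarrow> nat" where
  "pair_count (Jfin r l) (Jfin s v) = (if l * v = 1 then min r s else 0)"
| "pair_count (Jfin r l) (Jinf s) = (if l = 0 then min r s else 0)"
| "pair_count (Jinf r) (Jfin s v) = (if v = 0 then min r s else 0)"
| "pair_count (Jinf r) (Jinf s) = 0"
| "pair_count (Jfin r l) (Lblk s) = r"
| "pair_count (Lblk r) (Jfin s v) = s"
| "pair_count (Jfin r l) (LTblk s) = 0"
| "pair_count (LTblk r) (Jfin s v) = 0"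
| "pair_count (Jinf r) (Lblk s) = r"
| "pair_count (Lblk r) (Jinf s) = s"
| "pair_count (Jinf r) (LTblk s) = 0"
| "pair_count (LTblk r) (Jinf s) = 0"
| "pair_count (Lblk r) (Lblk s) = r + s"
| "pair_count (Lblk r) (LTblk s) = Suc s - r"
| "pair_count (LTblk r) (Lblk s) = Suc r - s"
| "pair_count (LTblk r) (LTblk s) = 0"

lemma has_dim_self_block: "has_dim (self_space (block_act b)) (self_count b)"
  using self_Jfin self_L has_dim_self_trivial[OF lin_pencil_block_act] pair_Jinf_Jinf pair_LT_LT
  by (cases b) (simp_all del: block_act.simps)

lemma has_dim_pair_block: "has_dim (pair_space (block_act a) (block_act b)) (pair_count a b)"
proof -
  note commute = has_dim_pair_commute[OF lin_pencil_block_act lin_pencil_block_act]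
  have JJ: "has_dim (pair_space (block_act (Jfin r l)) (block_act (Jfin s v)))
      (pair_count (Jfin r l) (Jfin s v))" for r l s v
    using pair_Jfin_Jfin pair_Jfin_Jfin_trivial by (simp del: block_act.simps)
  have JI: "has_dim (pair_space (block_act (Jfin r l)) (block_act (Jinf s)))
      (pair_count (Jfin r l) (Jinf s))" for r l s
    using pair_nilpotent_Jinf pair_Jfin_Jinf_trivial by (simp del: block_act.simps)
  have IJ: "has_dim (pair_space (block_act (Jinf r)) (block_act (Jfin s v)))
      (pair_count (Jinf r) (Jfin s v))" for r s v
    using commute[OF JI[of s v r]] by (auto simp del: block_act.simps simp: min.commute)
  show ?thesis
    using JJ JI IJ pair_Jinf_Jinf pair_Jfin_L pair_Jfin_LT pair_Jinf_L pair_Jinf_LT pair_L_L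
      pair_L_LT pair_LT_LT commute[OF pair_Jfin_L] commute[OF pair_Jfin_LT] commute[OF pair_Jinf_L]
      commute[OF pair_Jinf_LT] commute[OF pair_L_LT]
    by (cases a; cases b) (simp_all only: pair_count.simps)
qed

definition sum_act :: "kronecker_block list \<Rightarrow> act_pencil" where
  "sum_act bs = foldr (\<lambda>b. direct_sum (block_act b)) bs empty_pencil"

fun total_count :: "kronecker_block list \<Rightarrow> nat" where
  "total_count [] = 0"
| "total_count (b # bs) = self_count b + (\<Sum>x\<leftarrow>bs. pair_count b x) + total_count bs"

lemma lin_pencil_sum_act: "lin_pencil (sum_act bs)"
proof (induction bs)
  case Nil
  show ?case by (simp add: sum_act_def lin_pencil_def empty_pencil_def lin_def)
qed (simp add: sum_act_def lin_pencil_direct_sum lin_pencil_block_act)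

lemma has_dim_pair_sum_act: "has_dim (pair_space (block_act b) (sum_act bs)) (\<Sum>x\<leftarrow>bs. pair_count b x)"
proof (induction bs)
  case Nil
  show ?case by (simp add: sum_act_def has_dim_pair_empty)
next
  case (Cons x xs)
  then show ?case
    using has_dim_pair_direct_sum[OF lin_pencil_block_act lin_pencil_block_act lin_pencil_sum_act
        has_dim_pair_block] by (simp add: sum_act_def)
qed

lemma has_dim_self_sum_act: "has_dim (self_space (sum_act bs)) (total_count bs)"
proof (induction bs)
  case Nil
  show ?case by (simp add: sum_act_def has_dim_self_empty)
next
  case (Cons b bs)
  then show ?case
    using has_dim_self_direct_sum[OF lin_pencil_block_act lin_pencil_sum_act has_dim_self_block
        has_dim_pair_sum_act] by (simp add: sum_act_def)
qed

section \<open>Summing the contributions of the families\<close>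

definition cross_count :: "kronecker_block list \<Rightarrow> kronecker_block list \<Rightarrow> nat" where
  "cross_count xs ys = (\<Sum>x\<leftarrow>xs. \<Sum>y\<leftarrow>ys. pair_count x y)"

lemma cross_count_simps [simp]:
  "cross_count [] ys = 0"
  "cross_count (x # xs) ys = (\<Sum>y\<leftarrow>ys. pair_count x y) + cross_count xs ys"
  by (simp_all add: cross_count_def)

lemma cross_count_append:
  "cross_count (xs @ ys) zs = cross_count xs zs + cross_count ys zs"
  "cross_count zs (xs @ ys) = cross_count zs xs + cross_count zs ys"
  by (simp_all add: cross_count_def sum_list_addf)

lemma total_count_append:
  "total_count (xs @ ys) = total_count xs + total_count ys + cross_count xs ys"
  by (induction xs) simp_all

lemma cross_count_concat:
  "cross_count (concat (map f [0..<a])) ys = (\<Sum>j<a. cross_count (f j) ys)"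
  "cross_count ys (concat (map f [0..<a])) = (\<Sum>j<a. cross_count ys (f j))"
  by (induction a) (simp_all add: cross_count_append cross_count_def[of _ "[]"])

lemma index_pairs_Suc: "index_pairs (Suc a) = index_pairs a \<union> (\<lambda>j. (j, a)) ` {..<a}"
  by (auto simp: index_pairs_def)

lemma finite_index_pairs: "finite (index_pairs a)"
proof (rule finite_subset)
  show "index_pairs a \<subseteq> {..<a} \<times> {..<a}" by (auto simp: index_pairs_def)
qed simp

lemma sum_index_pairs_if:
  fixes f :: "nat \<Rightarrow> nat \<Rightarrow> nat"
  shows "(\<Sum>(j, k)\<in>index_pairs a. if P j k then f j k else 0)
    = (\<Sum>(j, k)\<in>{(j, k) \<in> index_pairs a. P j k}. f j k)"
  by (rule sum.mono_neutral_cong_right) (auto simp: finite_index_pairs split: if_splits)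

lemma total_count_concat:
  "total_count (concat (map f [0..<a])) =
     (\<Sum>j<a. total_count (f j)) + (\<Sum>(j, k)\<in>index_pairs a. cross_count (f j) (f k))"
proof (induction a)
  case 0
  show ?case by (simp add: index_pairs_def)
next
  case (Suc a)
  have "(\<Sum>(j, k)\<in>index_pairs (Suc a). cross_count (f j) (f k)) =
      (\<Sum>(j, k)\<in>index_pairs a. cross_count (f j) (f k))
      + (\<Sum>(j, k)\<in>(\<lambda>j. (j, a)) ` {..<a}. cross_count (f j) (f k))"
    unfolding index_pairs_Suc
    by (rule sum.union_disjoint[OF finite_index_pairs]) (auto simp: index_pairs_def)
  also have "(\<Sum>(j, k)\<in>(\<lambda>j. (j, a)) ` {..<a}. cross_count (f j) (f k)) = (\<Sum>j<a. cross_count (f j) (f a))"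
    by (subst sum.reindex) (auto simp: inj_on_def)
  finally show ?case
    using Suc by (simp add: total_count_append cross_count_concat)
qed

lemma cross_count_families:
  "cross_count (concat (map f [0..<a])) (concat (map g [0..<b])) = (\<Sum>j<a. \<Sum>k<b. cross_count (f j) (g k))"
  by (simp only: cross_count_concat(1), simp only: cross_count_concat(2))

lemma minus_eq_one_iff: "- x = 1 \<longleftrightarrow> x = (-1 :: complex)" "-1 = x \<longleftrightarrow> x = (-1 :: complex)"
  by (auto simp: minus_equation_iff)

lemma floor_half: "\<lfloor>real m / 2\<rfloor> = int (m div 2)"
  by linarith

lemma ceiling_half: "\<lceil>real m / 2\<rceil> = int ((m + 1) div 2)"
  by linarith

lemma D_L_eq: "int (total_count (concat (map (\<lambda>j. paired_L (s j)) [0..<a]))) = D_L a s"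
proof -
  have "cross_count (paired_L u) (paired_L v) = max (2 * u + 1) (2 * v + 1) + (if u = v then 1 else 0)" for u v
    by (auto simp: paired_L_def max_def)
  moreover have "total_count (paired_L u) = u + 1" for u by (simp add: paired_L_def)
  moreover have "(\<Sum>(j, k)\<in>index_pairs a. if s j = s k then 1 else 0) = card {(j, k) \<in> index_pairs a. s j = s k}"
    using sum_index_pairs_if[of "\<lambda>j k. s j = s k" "\<lambda>_ _. 1" a]
    by (simp add: case_prod_unfold)
  ultimately have "total_count (concat (map (\<lambda>j. paired_L (s j)) [0..<a])) =
     (\<Sum>j<a. s j + 1) + ((\<Sum>(j, k)\<in>index_pairs a. max (2 * s j + 1) (2 * s k + 1))
       + card {(j, k) \<in> index_pairs a. s j = s k})"
    by (simp only: total_count_concat case_prod_unfold sum.distrib)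
  then show ?thesis by (simp add: D_L_def case_prod_unfold)
qed

lemma D_Z_eq: "int (total_count (concat (map (\<lambda>j. paired_Z (t j)) [0..<b]))) = D_Z b t"
proof -
  have "cross_count (paired_Z u) (paired_Z v) = min (2 * u) (2 * v)" for u v
    by (auto simp: paired_Z_def min_def)
  moreover have "total_count (paired_Z u) = u" for u by (simp add: paired_Z_def)
  ultimately show ?thesis
    by (simp add: total_count_concat D_Z_def case_prod_unfold)
qed

lemma D_one_eq: "int (total_count (concat (map (\<lambda>j. [Jfin (m j) 1]) [0..<c]))) = D_one c m"
  unfolding total_count_concat D_one_def floor_half by (simp add: case_prod_unfold)

lemma D_minus_one_eq: "int (total_count (concat (map (\<lambda>j. [Jfin (q j) (-1)]) [0..<d]))) = D_minus_one d q"
  unfolding total_count_concat D_minus_one_def ceiling_half by (simp add: case_prod_unfold)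

text \<open>Among the four products of \<open>x, 1/x\<close> with \<open>y, 1/y\<close>, none is \<open>1\<close> if the eigenvalues are not similar.
  Otherwise exactly two are: \<open>x y = 1\<close> and \<open>x = y\<close> exclude each other because \<open>x\<^sup>2 \<noteq> 1\<close>.\<close>

lemma cross_count_paired_J:
  assumes "x \<noteq> 0" "y \<noteq> 0" "x \<noteq> 1" "x \<noteq> -1"
  shows "cross_count (paired_J u x) (paired_J v y) = (if sim_eigenvalue x y then min (2 * u) (2 * v) else 0)"
proof -
  have sim: "sim_eigenvalue x y \<longleftrightarrow> x = y \<or> x * y = 1"
    using assms by (auto simp: sim_eigenvalue_def doubleton_eq_iff field_simps)
  have "x * y = 1 \<Longrightarrow> x \<noteq> y"
  proof
    assume "x * y = 1" "x = y"
    then have "(x - 1) * (x + 1) = 0" by (simp add: algebra_simps)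
    then show False using assms by (auto simp: eq_neg_iff_add_eq_0)
  qed
  moreover have "x * (1 / y) = 1 \<longleftrightarrow> x = y" "1 / x * y = 1 \<longleftrightarrow> x = y" "1 / x * (1 / y) = 1 \<longleftrightarrow> x * y = 1"
    using assms by (auto simp: field_simps)
  ultimately show ?thesis
    unfolding sim by (auto simp: paired_J_def min_def)
qed

lemma D_P_eq:
  assumes "\<And>j. j < e \<Longrightarrow> lam j \<noteq> 1 \<and> lam j \<noteq> -1 \<and> lam j \<noteq> 0"
  shows "int (total_count (concat (map (\<lambda>j. paired_J (p j) (lam j)) [0..<e]))) = D_P e p lam"
proof -
  have "total_count (paired_J (p j) (lam j)) = p j" if "j < e" for j
    using assms[OF that] by (auto simp: paired_J_def divide_eq_eq minus_eq_one_iff)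
  then have 1: "(\<Sum>j<e. total_count (paired_J (p j) (lam j))) = (\<Sum>j<e. p j)" by simp
  have "(\<Sum>(j, k)\<in>index_pairs e. cross_count (paired_J (p j) (lam j)) (paired_J (p k) (lam k)))
     = (\<Sum>(j, k)\<in>index_pairs e. if sim_eigenvalue (lam j) (lam k) then min (2 * p j) (2 * p k) else 0)"
  proof (intro sum.cong refl, clarify)
    fix j k assume "(j, k) \<in> index_pairs e"
    then have "j < e" "k < e" by (auto simp: index_pairs_def)
    then show "cross_count (paired_J (p j) (lam j)) (paired_J (p k) (lam k))
        = (if sim_eigenvalue (lam j) (lam k) then min (2 * p j) (2 * p k) else 0)"
      using assms by (intro cross_count_paired_J) auto
  qed
  also have "\<dots> = (\<Sum>(j, k)\<in>{(j, k) \<in> index_pairs e. sim_eigenvalue (lam j) (lam k)}. min (2 * p j) (2 * p k))"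
    by (rule sum_index_pairs_if)
  finally show ?thesis using 1 by (simp add: total_count_concat D_P_def case_prod_unfold)
qed

text \<open>Different families interact only if one of them is that of the \<open>L\<^sub>s\<close>.  Each \<open>L\<^sub>s\<close> then contributes the
  size of every Jordan block, in total the size of the regular part, which is \<open>n\<close> minus the size of
  the singular part.\<close>

lemma total_count_structure:
  assumes lam: "\<And>j. j < e \<Longrightarrow> lam j \<noteq> 1 \<and> lam j \<noteq> -1 \<and> lam j \<noteq> 0"
    and bs: "bs = concat (map (\<lambda>j. paired_L (s j)) [0..<a]) @
            concat (map (\<lambda>j. paired_Z (t j)) [0..<b]) @
            map (\<lambda>j. Jfin (m j) 1) [0..<c] @
            map (\<lambda>j. Jfin (q j) (-1)) [0..<d] @
            concat (map (\<lambda>j. paired_J (p j) (lam j)) [0..<e])"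
    and n: "n = (\<Sum>x\<leftarrow>bs. nrows (block_act x))"
  shows "int (total_count bs) =
           D_L a s + D_Z b t + D_one c m + D_minus_one d q + D_P e p lam + D_I n a s"
proof -
  define L where "L = concat (map (\<lambda>j. paired_L (s j)) [0..<a])"
  define Z where "Z = concat (map (\<lambda>j. paired_Z (t j)) [0..<b])"
  define U where "U = concat (map (\<lambda>j. [Jfin (m j) 1]) [0..<c])"
  define V where "V = concat (map (\<lambda>j. [Jfin (q j) (-1)]) [0..<d])"
  define R where "R = concat (map (\<lambda>j. paired_J (p j) (lam j)) [0..<e])"
  have bs': "bs = L @ Z @ U @ V @ R"
    unfolding bs L_def Z_def U_def V_def R_def by (simp add: concat_map_singleton)
  have "1 / lam j \<noteq> -1" if "j < e" for j
    using lam[OF that] by (metis divide_divide_eq_right divide_minus1 div_by_1 mult_1 nonzero_divide_eq_eq)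
  then have zero: "cross_count Z U = 0" "cross_count Z V = 0" "cross_count Z R = 0"
    "cross_count U V = 0" "cross_count U R = 0" "cross_count V R = 0"
    unfolding Z_def U_def V_def R_def cross_count_families using lam
    by (auto simp: paired_Z_def paired_J_def minus_eq_one_iff)
  have "cross_count L Z = a * (\<Sum>k<b. 2 * t k)" "cross_count L U = a * (\<Sum>k<c. m k)"
    "cross_count L V = a * (\<Sum>k<d. q k)" "cross_count L R = a * (\<Sum>k<e. 2 * p k)"
    unfolding L_def Z_def U_def V_def R_def cross_count_families
    by (simp_all add: paired_L_def paired_Z_def paired_J_def mult_2)
  moreover have size: "(\<Sum>x\<leftarrow>concat (map f [0..<k]). nrows (block_act x))
      = (\<Sum>j<k. \<Sum>x\<leftarrow>f j. nrows (block_act x))" for f :: "nat \<Rightarrow> kronecker_block list" and k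
    by (induction k) simp_all
  have "n = (\<Sum>j<a. 2 * s j + 1) + (\<Sum>k<b. 2 * t k) + (\<Sum>k<c. m k) + (\<Sum>k<d. q k) + (\<Sum>k<e. 2 * p k)"
    unfolding n bs' L_def Z_def U_def V_def R_def map_append sum_list_append size
    by (simp add: paired_L_def paired_Z_def paired_J_def mult_2)
  then have "int (a * (\<Sum>k<b. 2 * t k) + a * (\<Sum>k<c. m k) + a * (\<Sum>k<d. q k) + a * (\<Sum>k<e. 2 * p k)) = D_I n a s"
    unfolding D_I_product_form by (simp add: algebra_simps)
  ultimately have "int (cross_count L Z + cross_count L U + cross_count L V + cross_count L R) = D_I n a s"
    by simp
  moreover have "int (total_count bs) = int (total_count L) + int (total_count Z) + int (total_count U)
      + int (total_count V) + int (total_count R)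
      + int (cross_count L Z + cross_count L U + cross_count L V + cross_count L R)"
    unfolding bs' by (simp add: total_count_append cross_count_append zero)
  ultimately show ?thesis
    using D_L_eq[of s a] D_Z_eq[of t b] D_one_eq[of m c] D_minus_one_eq[of q d] D_P_eq[of e lam p, OF lam]
    unfolding L_def Z_def U_def V_def R_def by simp
qed

section \<open>Kronecker pencils as matrices\<close>

definition mat_act :: "complex mat \<Rightarrow> (nat \<Rightarrow> complex) \<Rightarrow> nat \<Rightarrow> complex" where
  "mat_act A x i = (\<Sum>k<dim_col A. A $$ (i, k) * x k)"

fun block_mat0 :: "kronecker_block \<Rightarrow> complex mat" where
  "block_mat0 (Jfin r l) = jordan_block r l"
| "block_mat0 (Jinf r) = 1\<^sub>m r"
| "block_mat0 (Lblk r) = mat r (r + 1) (\<lambda>(i, j). if j = i + 1 then 1 else 0)"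
| "block_mat0 (LTblk r) = mat (r + 1) r (\<lambda>(i, j). if i = j + 1 then 1 else 0)"

fun block_mat1 :: "kronecker_block \<Rightarrow> complex mat" where
  "block_mat1 (Jfin r l) = 1\<^sub>m r"
| "block_mat1 (Jinf r) = jordan_block r 0"
| "block_mat1 (Lblk r) = mat r (r + 1) (\<lambda>(i, j). if j = i then 1 else 0)"
| "block_mat1 (LTblk r) = mat (r + 1) r (\<lambda>(i, j). if i = j then 1 else 0)"

lemma dim_block_mat [simp]:
  "dim_row (block_mat0 b) = nrows (block_act b)" "dim_col (block_mat0 b) = ncols (block_act b)"
  "dim_row (block_mat1 b) = nrows (block_act b)" "dim_col (block_mat1 b) = ncols (block_act b)"
  by (cases b; simp)+

lemma dim_pencil [simp]:
  "dim_row (pencil A B) = dim_row B" "dim_col (pencil A B) = dim_col B"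
  by (simp_all add: pencil_def const_mat_def)

lemma index_pencil:
  "i < dim_row A \<Longrightarrow> j < dim_col A \<Longrightarrow> dim_row A = dim_row B \<Longrightarrow> dim_col A = dim_col B \<Longrightarrow>
    pencil A B $$ (i, j) = [: A $$ (i, j), - B $$ (i, j) :]"
  by (simp add: pencil_def const_mat_def)

lemma block_pencil_eq: "block_pencil b = pencil (block_mat0 b) (block_mat1 b)"
proof (cases b)
  case (LTblk r)
  show ?thesis unfolding LTblk
    by (rule eq_matI) (auto simp: L_pencil_def index_pencil)
qed (auto simp: L_pencil_def)

definition sum_mat0 :: "kronecker_block list \<Rightarrow> complex mat" where
  "sum_mat0 bs = diag_block_mat (map block_mat0 bs)"

definition sum_mat1 :: "kronecker_block list \<Rightarrow> complex mat" where
  "sum_mat1 bs = diag_block_mat (map block_mat1 bs)"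

lemma dim_sum_mat [simp]:
  "dim_row (sum_mat0 bs) = nrows (sum_act bs)" "dim_col (sum_mat0 bs) = ncols (sum_act bs)"
  "dim_row (sum_mat1 bs) = nrows (sum_act bs)" "dim_col (sum_mat1 bs) = ncols (sum_act bs)"
  by (induction bs) (simp_all add: sum_mat0_def sum_mat1_def sum_act_def empty_pencil_def direct_sum_def Let_def)

lemma diag_block_pencil_eq: "diag_block_mat (map block_pencil bs) = pencil (sum_mat0 bs) (sum_mat1 bs)"
proof (induction bs)
  case Nil
  show ?case by (rule eq_matI) (simp_all add: sum_mat0_def sum_mat1_def)
next
  case (Cons b bs)
  let ?four = "\<lambda>A D. four_block_mat A (0\<^sub>m (dim_row A) (dim_col D)) (0\<^sub>m (dim_row D) (dim_col A)) D"
  have s: "sum_mat0 (b # bs) = ?four (block_mat0 b) (sum_mat0 bs)"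
    "sum_mat1 (b # bs) = ?four (block_mat1 b) (sum_mat1 bs)"
    by (simp_all only: sum_mat0_def sum_mat1_def list.map diag_block_mat.simps Let_def)
  have "diag_block_mat (map block_pencil (b # bs))
      = ?four (pencil (block_mat0 b) (block_mat1 b)) (pencil (sum_mat0 bs) (sum_mat1 bs))"
    by (simp only: list.map diag_block_mat.simps Let_def Cons block_pencil_eq)
  also have "\<dots> = pencil (sum_mat0 (b # bs)) (sum_mat1 (b # bs))"
    by (rule eq_matI) (auto simp: s index_pencil)
  finally show ?case .
qed

lemma sum_single:
  fixes c i :: nat
  shows "(\<Sum>k<c. (if k = i then a else 0) * x k) = (if i < c then a * x i else (0::complex))"
proof -
  have "(\<Sum>k<c. (if k = i then a else 0) * x k) = (\<Sum>k<c. if k = i then a * x k else 0)"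
    by (intro sum.cong) auto
  also have "\<dots> = (if i \<in> {..<c} then a * x i else 0)" by (rule sum.delta) simp
  finally show ?thesis by simp
qed

lemma sum_lessThan_add:
  fixes f :: "nat \<Rightarrow> complex"
  shows "(\<Sum>k<a + b. f k) = (\<Sum>k<a. f k) + (\<Sum>k<b. f (k + a))"
  by (induction b) (simp_all add: add.commute add.left_commute)

lemma mat_act_block:
  assumes "\<And>k. k \<ge> ncols (block_act b) \<Longrightarrow> x k = 0" and "i < nrows (block_act b)"
  shows "mat_act (block_mat0 b) x i = act0 (block_act b) x i"
    and "mat_act (block_mat1 b) x i = act1 (block_act b) x i"
proof -
  have jb: "(\<Sum>k<r. (if i = k then l else if Suc i = k then 1 else 0) * x k) = l * x i + x (Suc i)"
    if "i < r" "\<And>k. k \<ge> r \<Longrightarrow> x k = 0" for r l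
  proof -
    have "(\<Sum>k<r. (if i = k then l else if Suc i = k then 1 else 0) * x k)
        = (\<Sum>k<r. (if k = i then l else 0) * x k + (if k = Suc i then 1 else 0) * x k)"
      by (intro sum.cong) auto
    then show ?thesis using that by (simp add: sum.distrib sum_single)
  qed
  have one: "(\<Sum>k<r. (if i = k then 1 else 0) * x k) = x i" if "i < r" for r
  proof -
    have "(\<Sum>k<r. (if i = k then 1 else 0) * x k) = (\<Sum>k<r. (if k = i then 1 else 0) * x k)"
      by (intro sum.cong) auto
    then show ?thesis using that by (simp add: sum_single)
  qed
  show "mat_act (block_mat0 b) x i = act0 (block_act b) x i"
  proof (cases b)
    case (LTblk r)
    have "(\<Sum>k<r. (if i = k + 1 then 1 else 0) * x k) = (if i = 0 then 0 else x (i - 1))"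
    proof (cases i)
      case (Suc i')
      have "(\<Sum>k<r. (if i = k + 1 then 1 else 0) * x k) = (\<Sum>k<r. (if k = i' then 1 else 0) * x k)"
        by (intro sum.cong) (auto simp: Suc)
      then show ?thesis using assms LTblk Suc by (simp add: sum_single)
    qed simp
    then show ?thesis using assms LTblk by (simp add: mat_act_def)
  qed (use assms in \<open>simp_all add: mat_act_def jb one sum_single\<close>)
  show "mat_act (block_mat1 b) x i = act1 (block_act b) x i"
  proof (cases b)
    case (LTblk r)
    have "(\<Sum>k<r. (if i = k then 1 else 0) * x k) = (\<Sum>k<r. (if k = i then 1 else 0) * x k)"
      by (intro sum.cong) auto
    then show ?thesis using assms LTblk by (simp add: mat_act_def sum_single)
  qed (use assms in \<open>simp_all add: mat_act_def jb one sum_single\<close>)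
qed

lemma mat_act_four_block:
  assumes A: "dim_row A = r" "dim_col A = c" and D: "dim_row D = r'" "dim_col D = c'"
    and i: "i < r + r'"
  shows "mat_act (four_block_mat A (0\<^sub>m r c') (0\<^sub>m r' c) D) x i
    = (if i < r then mat_act A (trunc c x) i else mat_act D (\<lambda>k. x (k + c)) (i - r))"
proof -
  have "mat_act (four_block_mat A (0\<^sub>m r c') (0\<^sub>m r' c) D) x i
     = (\<Sum>k<c + c'. (if i < r then (if k < c then A $$ (i, k) else 0)
          else (if k < c then 0 else D $$ (i - r, k - c))) * x k)"
    unfolding mat_act_def using assms by (intro sum.cong) auto
  also have "\<dots> = (\<Sum>k<c. (if i < r then A $$ (i, k) else 0) * x k)
     + (\<Sum>k<c'. (if i < r then 0 else D $$ (i - r, k)) * x (k + c))"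
    unfolding sum_lessThan_add by (intro arg_cong2[where f = "(+)"] sum.cong) auto
  finally show ?thesis by (simp add: mat_act_def trunc_def A D)
qed

lemma mat_act_sum:
  assumes "\<And>k. k \<ge> ncols (sum_act bs) \<Longrightarrow> x k = 0" and "i < nrows (sum_act bs)"
  shows "mat_act (sum_mat0 bs) x i = act0 (sum_act bs) x i \<and>
    mat_act (sum_mat1 bs) x i = act1 (sum_act bs) x i"
  using assms
proof (induction bs arbitrary: x i)
  case Nil
  then show ?case by (simp add: sum_act_def empty_pencil_def)
next
  case (Cons b bs)
  let ?r = "nrows (block_act b)" and ?c = "ncols (block_act b)"
  have s: "sum_act (b # bs) = direct_sum (block_act b) (sum_act bs)" by (simp add: sum_act_def)
  let ?four = "\<lambda>A D. four_block_mat A (0\<^sub>m (dim_row A) (dim_col D)) (0\<^sub>m (dim_row D) (dim_col A)) D"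
  have m: "sum_mat0 (b # bs) = ?four (block_mat0 b) (sum_mat0 bs)"
    "sum_mat1 (b # bs) = ?four (block_mat1 b) (sum_mat1 bs)"
    by (simp_all only: sum_mat0_def sum_mat1_def list.map diag_block_mat.simps Let_def)
  have i: "i < ?r + nrows (sum_act bs)" using Cons.prems(2) by (simp add: s direct_sum_def)
  show ?case
  proof (cases "i < ?r")
    case True
    have tz: "trunc ?c x k = 0" if "k \<ge> ?c" for k using that by (simp add: trunc_def)
    show ?thesis
      using mat_act_block[of b "trunc ?c x" i, OF tz True] True i
      by (simp add: m mat_act_four_block s direct_sum_def)
  next
    case False
    have "mat_act (sum_mat0 bs) (\<lambda>k. x (k + ?c)) (i - ?r) = act0 (sum_act bs) (\<lambda>k. x (k + ?c)) (i - ?r) \<and>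
      mat_act (sum_mat1 bs) (\<lambda>k. x (k + ?c)) (i - ?r) = act1 (sum_act bs) (\<lambda>k. x (k + ?c)) (i - ?r)"
    proof (rule Cons.IH)
      show "x (k + ?c) = 0" if "k \<ge> ncols (sum_act bs)" for k
        using that by (intro Cons.prems(1)) (simp add: s direct_sum_def)
    qed (use False i in auto)
    then show ?thesis using False i by (simp add: m mat_act_four_block s direct_sum_def)
  qed
qed

definition entries :: "complex mat \<Rightarrow> nat \<times> nat \<Rightarrow> complex" where
  "entries A = (\<lambda>(i, j). if i < dim_row A \<and> j < dim_col A then A $$ (i, j) else 0)"

lemma entries_in_self_space_iff:
  assumes C: "C \<in> carrier_mat (ncols (sum_act bs)) (nrows (sum_act bs))"
  shows "entries C \<in> self_space (sum_act bs) \<longleftrightarrow>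
    sum_mat0 bs * C + transpose_mat (sum_mat1 bs * C) = 0\<^sub>m (nrows (sum_act bs)) (nrows (sum_act bs))"
proof -
  let ?r = "nrows (sum_act bs)" and ?c = "ncols (sum_act bs)"
  have index: "(M * C) $$ (i, j) = mat_act M (\<lambda>k. entries C (k, j)) i"
    if "i < ?r" "j < ?r" "dim_row M = ?r" "dim_col M = ?c" for M i j
    using that C by (auto simp: mat_act_def entries_def scalar_prod_def atLeast0LessThan intro!: sum.cong)
  have "mat_act (sum_mat0 bs) (\<lambda>k. entries C (k, j)) i = act0 (sum_act bs) (\<lambda>k. entries C (k, j)) i \<and>
    mat_act (sum_mat1 bs) (\<lambda>k. entries C (k, j)) i = act1 (sum_act bs) (\<lambda>k. entries C (k, j)) i"
    if "i < ?r" for i j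
    by (rule mat_act_sum) (use C that in \<open>auto simp: entries_def\<close>)
  then have ix: "(sum_mat0 bs * C + transpose_mat (sum_mat1 bs * C)) $$ (i, j) =
      act0 (sum_act bs) (\<lambda>k. entries C (k, j)) i + act1 (sum_act bs) (\<lambda>k. entries C (k, i)) j"
    if "i < ?r" "j < ?r" for i j
    using that C index[of i j "sum_mat0 bs"] index[of j i "sum_mat1 bs"] by auto
  have "entries C \<in> self_space (sum_act bs) \<longleftrightarrow> (\<forall>i<?r. \<forall>j<?r.
      act0 (sum_act bs) (\<lambda>k. entries C (k, j)) i + act1 (sum_act bs) (\<lambda>k. entries C (k, i)) j = 0)"
    using C by (auto simp: self_space_def entries_def)
  also have "\<dots> \<longleftrightarrow> (\<forall>i<?r. \<forall>j<?r. (sum_mat0 bs * C + transpose_mat (sum_mat1 bs * C)) $$ (i, j) = 0)"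
    using ix by auto
  also have "\<dots> \<longleftrightarrow> sum_mat0 bs * C + transpose_mat (sum_mat1 bs * C) = 0\<^sub>m ?r ?r"
    using C by (auto simp: mat_eq_iff)
  finally show ?thesis .
qed

lemma bij_betw_entries:
  "bij_betw entries
     {C \<in> carrier_mat (ncols (sum_act bs)) (nrows (sum_act bs)).
        sum_mat0 bs * C + transpose_mat (sum_mat1 bs * C) = 0\<^sub>m (nrows (sum_act bs)) (nrows (sum_act bs))}
     (self_space (sum_act bs))"
  (is "bij_betw _ ?S _")
proof -
  let ?r = "nrows (sum_act bs)" and ?c = "ncols (sum_act bs)"
  have inv: "entries (mat ?c ?r x) = x" if "x \<in> self_space (sum_act bs)" for x
    using that by (auto simp: self_space_def entries_def fun_eq_iff)
  show ?thesis
  proof (rule bij_betw_byWitness[where f' = "mat ?c ?r"])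
    show "\<forall>C\<in>?S. mat ?c ?r (entries C) = C" by (auto simp: entries_def intro!: eq_matI)
    show "\<forall>x\<in>self_space (sum_act bs). entries (mat ?c ?r x) = x" using inv by blast
    show "entries ` ?S \<subseteq> self_space (sum_act bs)" using entries_in_self_space_iff by blast
    show "mat ?c ?r ` self_space (sum_act bs) \<subseteq> ?S"
    proof (intro image_subsetI CollectI conjI)
      fix x assume x: "x \<in> self_space (sum_act bs)"
      show "mat ?c ?r x \<in> carrier_mat ?c ?r" by simp
      then show "sum_mat0 bs * mat ?c ?r x + transpose_mat (sum_mat1 bs * mat ?c ?r x) = 0\<^sub>m ?r ?r"
        using x entries_in_self_space_iff inv[OF x] by metis
    qed
  qed
qed

section \<open>Transport along strict equivalence\<close>

text \<open>The coefficients of the powers of \<open>\<mu>\<close> are compared entry by entry.\<close>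

lemma strict_equivalence_coefficients:
  assumes A: "A \<in> carrier_mat n n" and B: "B \<in> carrier_mat n n"
    and P: "P \<in> carrier_mat n n" and Q: "Q \<in> carrier_mat n n"
    and dims: "dim_row A' = dim_row B'" "dim_col A' = dim_col B'"
    and eq: "const_mat P * pencil A B * const_mat Q = pencil A' B'"
  shows "A' = P * A * Q" "B' = P * B * Q"
proof -
  have d: "dim_row B' = n" "dim_col B' = n"
    using arg_cong[OF eq, of dim_row] arg_cong[OF eq, of dim_col] P Q by (auto simp: const_mat_def)
  have pen: "pencil A B $$ (i, j) = [: A $$ (i, j), - B $$ (i, j) :]" if "i < n" "j < n" for i j
    using A B that by (intro index_pencil) auto
  have "pencil A' B' $$ (i, j) = [: (P * A * Q) $$ (i, j), - (P * B * Q) $$ (i, j) :]"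
    if ij: "i < n" "j < n" for i j
  proof -
    have "(const_mat P * pencil A B * const_mat Q) $$ (i, j) =
        (\<Sum>k<n. (\<Sum>l<n. [: P $$ (i, l) :] * pencil A B $$ (l, k)) * [: Q $$ (k, j) :])"
      using A B P Q ij by (simp add: scalar_prod_def const_mat_def atLeast0LessThan)
    also have "\<dots> = (\<Sum>k<n. (\<Sum>l<n. [: P $$ (i, l) * A $$ (l, k) * Q $$ (k, j), - (P $$ (i, l) * B $$ (l, k) * Q $$ (k, j)) :]))"
      unfolding sum_distrib_right by (intro sum.cong) (auto simp: pen)
    also have "\<dots> = [: \<Sum>k<n. \<Sum>l<n. P $$ (i, l) * A $$ (l, k) * Q $$ (k, j),
        - (\<Sum>k<n. \<Sum>l<n. P $$ (i, l) * B $$ (l, k) * Q $$ (k, j)) :]"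
      by (rule poly_eqI) (simp add: coeff_sum coeff_pCons sum_negf split: nat.split)
    also have "\<dots> = [: (P * A * Q) $$ (i, j), - (P * B * Q) $$ (i, j) :]"
      using A B P Q ij
      by (simp add: scalar_prod_def atLeast0LessThan sum_distrib_right del: assoc_mult_mat)
    finally show ?thesis using eq by simp
  qed
  moreover have "pencil A' B' $$ (i, j) = [: A' $$ (i, j), - B' $$ (i, j) :]" if "i < n" "j < n" for i j
    using d dims that by (intro index_pencil) auto
  ultimately have "A' $$ (i, j) = (P * A * Q) $$ (i, j) \<and> B' $$ (i, j) = (P * B * Q) $$ (i, j)"
    if "i < n" "j < n" for i j using that by fastforce
  then show "A' = P * A * Q" "B' = P * B * Q"
    using d dims P Q by (auto intro!: eq_matI)
qed

lemma invertible_matE: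
  assumes "invertible_mat P" "P \<in> carrier_mat n n"
  obtains P' where "P' \<in> carrier_mat n n" "P * P' = 1\<^sub>m n" "P' * P = 1\<^sub>m n"
proof -
  obtain P' where "inverts_mat P P'" "inverts_mat P' P" using assms(1) by (auto simp: invertible_mat_def)
  then have e: "P * P' = 1\<^sub>m n" "P' * P = 1\<^sub>m (dim_row P')" using assms(2) by (auto simp: inverts_mat_def)
  have "dim_col P' = n" using arg_cong[OF e(1), of dim_col] by simp
  moreover have "dim_row P' = n" using arg_cong[OF e(2), of dim_col] assms(2) by simp
  ultimately show thesis using that[of P'] e by auto
qed

text \<open>With \<open>X = Q C P\<^sup>-\<^sup>T\<close> the new equation is \<open>P (X\<^sup>T J + J X) P\<^sup>T = 0\<close>.\<close>

lemma bij_betw_solution_space: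
  assumes J: "J \<in> carrier_mat n n"
    and P: "P \<in> carrier_mat n n" "P' \<in> carrier_mat n n" "P * P' = 1\<^sub>m n" "P' * P = 1\<^sub>m n"
    and Q: "Q \<in> carrier_mat n n" "Q' \<in> carrier_mat n n" "Q * Q' = 1\<^sub>m n" "Q' * Q = 1\<^sub>m n"
  shows "bij_betw (\<lambda>X. Q' * X * transpose_mat P) (solution_space n J)
    {C \<in> carrier_mat n n. (P * J * Q) * C + transpose_mat ((P * transpose_mat J * Q) * C) = 0\<^sub>m n n}"
  (is "bij_betw ?f _ ?S")
proof (rule bij_betw_byWitness[where f' = "\<lambda>C. Q * C * transpose_mat P'"])
  note [simp] = assoc_mult_mat[of _ n n _ n _ n]
  have cancel: "A * (B * X) = X" if "A * B = 1\<^sub>m n" "A \<in> carrier_mat n n" "B \<in> carrier_mat n n"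
    "X \<in> carrier_mat n n" for A B X :: "complex mat"
    using that by (simp add: assoc_mult_mat[of A n n B n X n, symmetric] del: assoc_mult_mat)
  have PT: "transpose_mat P * transpose_mat P' = 1\<^sub>m n" "transpose_mat P' * transpose_mat P = 1\<^sub>m n"
    using P by (simp_all add: transpose_mult[symmetric])
  have key: "(P * J * Q) * ?f X + transpose_mat ((P * transpose_mat J * Q) * ?f X)
      = P * (transpose_mat X * J + J * X) * transpose_mat P" if X: "X \<in> carrier_mat n n" for X
  proof -
    have "(P * J * Q) * ?f X = P * (J * X) * transpose_mat P"
      using J P Q X by (simp add: cancel)
    moreover have "(P * transpose_mat J * Q) * ?f X = P * (transpose_mat J * X) * transpose_mat P"
      using J P Q X by (simp add: cancel)
    moreover have "transpose_mat (P * (transpose_mat J * X) * transpose_mat P)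
        = P * (transpose_mat X * J) * transpose_mat P"
      using J P Q X by (simp add: transpose_mult[of _ n n _ n])
    ultimately show ?thesis
      using J P Q X
      by (simp add: mult_add_distrib_mat[of _ n n _ n] add_mult_distrib_mat[of _ n n _ _ n] comm_add_mat[of _ n n])
  qed
  have cancel_P: "transpose_mat X * J + J * X = 0\<^sub>m n n"
    if "P * (transpose_mat X * J + J * X) * transpose_mat P = 0\<^sub>m n n" and X: "X \<in> carrier_mat n n" for X
  proof -
    have "P' * (P * Y * transpose_mat P) * transpose_mat P' = Y" if "Y \<in> carrier_mat n n" for Y
      using that P PT by (simp add: cancel)
    from this[of "transpose_mat X * J + J * X"] show ?thesis using that(1) P X J by simp
  qed
  have inv1: "Q * (?f X) * transpose_mat P' = X" if "X \<in> carrier_mat n n" for X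
    using that P Q PT by (simp add: cancel)
  have inv2: "?f (Q * X * transpose_mat P') = X" if "X \<in> carrier_mat n n" for X
    using that P Q PT by (simp add: cancel)
  show "\<forall>X\<in>solution_space n J. Q * (?f X) * transpose_mat P' = X"
    using inv1 by (auto simp: solution_space_def)
  show "\<forall>X\<in>?S. ?f (Q * X * transpose_mat P') = X" using inv2 by auto
  show "?f ` solution_space n J \<subseteq> ?S"
  proof (intro image_subsetI CollectI conjI)
    fix X assume X: "X \<in> solution_space n J"
    then have Xc: "X \<in> carrier_mat n n" by (simp add: solution_space_def)
    show "?f X \<in> carrier_mat n n" using Xc P Q by simp
    show "(P * J * Q) * ?f X + transpose_mat ((P * transpose_mat J * Q) * ?f X) = 0\<^sub>m n n"
      unfolding key[OF Xc] using X P by (simp add: solution_space_def del: assoc_mult_mat)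
  qed
  show "(\<lambda>C. Q * C * transpose_mat P') ` ?S \<subseteq> solution_space n J"
  proof (intro image_subsetI)
    fix C assume "C \<in> ?S"
    then have C: "C \<in> carrier_mat n n"
      and eq: "(P * J * Q) * C + transpose_mat ((P * transpose_mat J * Q) * C) = 0\<^sub>m n n" by auto
    let ?X = "Q * C * transpose_mat P'"
    have X: "?X \<in> carrier_mat n n" using C P Q by simp
    have "P * (transpose_mat ?X * J + J * ?X) * transpose_mat P = 0\<^sub>m n n"
      unfolding key[OF X, symmetric] inv2[OF C] by (rule eq)
    from cancel_P[OF this X] show "?X \<in> solution_space n J" using X by (simp add: solution_space_def)
  qed
qed

lemma nrows_sum_act: "nrows (sum_act bs) = (\<Sum>x\<leftarrow>bs. nrows (block_act x))"
  by (induction bs) (simp_all add: sum_act_def empty_pencil_def direct_sum_def)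

lemma dim_solution_space:
  assumes J: "J \<in> carrier_mat n n"
    and K: "has_kronecker_structure (pencil J (transpose_mat J)) bs"
  shows "nrows (sum_act bs) = n" "mat_subspace_dim n (solution_space n J) = total_count bs"
proof -
  have dim: "dim_row (pencil J (transpose_mat J)) = n" "dim_col (pencil J (transpose_mat J)) = n"
    using J by auto
  obtain P Q where PQ: "P \<in> carrier_mat n n" "invertible_mat P" "Q \<in> carrier_mat n n" "invertible_mat Q"
    and eq: "const_mat P * pencil J (transpose_mat J) * const_mat Q = pencil (sum_mat0 bs) (sum_mat1 bs)"
    using K unfolding has_kronecker_structure_def strictly_equivalent_def dim diag_block_pencil_eq by auto
  obtain P' where P: "P' \<in> carrier_mat n n" "P * P' = 1\<^sub>m n" "P' * P = 1\<^sub>m n"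
    using invertible_matE[OF PQ(2,1)] by blast
  obtain Q' where Q: "Q' \<in> carrier_mat n n" "Q * Q' = 1\<^sub>m n" "Q' * Q = 1\<^sub>m n"
    using invertible_matE[OF PQ(4,3)] by blast
  have JT: "transpose_mat J \<in> carrier_mat n n" using J by simp
  have sum: "sum_mat0 bs = P * J * Q" "sum_mat1 bs = P * transpose_mat J * Q"
    by (rule strict_equivalence_coefficients[OF J JT PQ(1,3) _ _ eq]; simp)+
  show r: "nrows (sum_act bs) = n"
    using arg_cong[OF sum(1), of dim_row] PQ by simp
  have c: "ncols (sum_act bs) = n"
    using arg_cong[OF sum(1), of dim_col] PQ by simp
  let ?g = "\<lambda>X. entries (Q' * X * transpose_mat P)"
  have bij: "bij_betw ?g (solution_space n J) (self_space (sum_act bs))"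
    using bij_betw_trans[OF bij_betw_solution_space[OF J PQ(1) P PQ(3) Q]
        bij_betw_entries[of bs, unfolded sum r c]] by (simp add: comp_def)
  obtain \<psi> where \<psi>: "lin \<psi>" "bij_betw \<psi> (self_space (sum_act bs)) (coord_space (total_count bs))"
    using has_dim_self_sum_act unfolding has_dim_def by blast
  have g: "?g (X + c \<cdot>\<^sub>m Y) = (\<lambda>p. ?g X p + c * ?g Y p)"
    if "X \<in> carrier_mat n n" "Y \<in> carrier_mat n n" for X Y c
  proof -
    have "Q' * (X + c \<cdot>\<^sub>m Y) * transpose_mat P = Q' * X * transpose_mat P + c \<cdot>\<^sub>m (Q' * Y * transpose_mat P)"
      using that PQ Q by (simp add: mult_add_distrib_mat[of _ n n _ n] add_mult_distrib_mat[of _ n n _ _ n]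
          mult_smult_distrib[of _ n n _ n] mult_smult_assoc_mat[of _ n n _ n])
    then show ?thesis using that PQ Q by (auto simp: entries_def fun_eq_iff)
  qed
  have \<psi>g: "\<psi> (?g (X + c \<cdot>\<^sub>m Y)) = (\<lambda>k. \<psi> (?g X) k + c * \<psi> (?g Y) k)"
    if "X \<in> carrier_mat n n" "Y \<in> carrier_mat n n" for X Y c
    using \<psi>(1) unfolding g[OF that] lin_def by blast
  have sol: "X + c \<cdot>\<^sub>m Y \<in> solution_space n J" if "X \<in> solution_space n J" "Y \<in> solution_space n J" for X Y c
  proof -
    have XY: "X \<in> carrier_mat n n" "Y \<in> carrier_mat n n"
      "transpose_mat X * J + J * X = 0\<^sub>m n n" "transpose_mat Y * J + J * Y = 0\<^sub>m n n"
      using that by (auto simp: solution_space_def)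
    have "transpose_mat (X + c \<cdot>\<^sub>m Y) * J + J * (X + c \<cdot>\<^sub>m Y)
       = (transpose_mat X * J + J * X) + c \<cdot>\<^sub>m (transpose_mat Y * J + J * Y)"
      using XY(1,2) J
      by (intro eq_matI) (auto simp: scalar_prod_def sum.distrib sum_distrib_left algebra_simps)
    then show ?thesis using XY J by (simp add: solution_space_def)
  qed
  have smult1: "X + 1 \<cdot>\<^sub>m Y = X + Y" "0\<^sub>m n n + c \<cdot>\<^sub>m Y = c \<cdot>\<^sub>m Y" if "Y \<in> carrier_mat n n" for X Y :: "complex mat" and c
    using that by (auto intro!: eq_matI)
  have zero: "0\<^sub>m n n \<in> solution_space n J" using J by (simp add: solution_space_def)
  have sub: "solution_space n J \<subseteq> carrier_mat n n" by (auto simp: solution_space_def)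
  have g0: "\<psi> (?g (0\<^sub>m n n)) = (\<lambda>_. 0)"
  proof -
    have "?g (0\<^sub>m n n) = (\<lambda>_. 0)" using PQ Q by (auto simp: entries_def)
    then show ?thesis using lin_zero[OF \<psi>(1)] by simp
  qed
  show "mat_subspace_dim n (solution_space n J) = total_count bs"
  proof (rule mat_subspace_dimI[where \<psi> = "\<lambda>X. \<psi> (?g X)"])
    show "bij_betw (\<lambda>X. \<psi> (?g X)) (solution_space n J) (coord_space (total_count bs))"
      using bij_betw_trans[OF bij \<psi>(2)] by (simp add: comp_def)
    fix X Y c assume X: "X \<in> solution_space n J"
    then show "c \<cdot>\<^sub>m X \<in> solution_space n J" using sol[OF zero X, of c] smult1 sub by auto
    show "\<psi> (?g (c \<cdot>\<^sub>m X)) = (\<lambda>k. c * \<psi> (?g X) k)"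
      using \<psi>g[of "0\<^sub>m n n" X c] X sub smult1(2)[of X c] g0 by auto
    assume Y: "Y \<in> solution_space n J"
    then show "X + Y \<in> solution_space n J" using sol[OF X Y, of 1] smult1 sub by auto
    show "\<psi> (?g (X + Y)) = (\<lambda>k. \<psi> (?g X) k + \<psi> (?g Y) k)"
      using \<psi>g[of X Y 1] X Y sub smult1(1)[of Y X] by auto
  qed (use zero sub in auto)
qed

theorem theorem3p3:
  fixes J :: "complex mat"
    and n a b c d e :: nat
    and s t m q p :: "nat \<Rightarrow> nat"
    and lam :: "nat \<Rightarrow> complex"
  assumes "J \<in> carrier_mat n n"
    and "has_kronecker_structure (pencil J (transpose_mat J))
           (concat (map (\<lambda>j. paired_L (s j)) [0..<a]) @
            concat (map (\<lambda>j. paired_Z (t j)) [0..<b]) @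
            map (\<lambda>j. Jfin (m j) 1) [0..<c] @
            map (\<lambda>j. Jfin (q j) (-1)) [0..<d] @
            concat (map (\<lambda>j. paired_J (p j) (lam j)) [0..<e]))"
    and "\<And>j. j < e \<Longrightarrow> lam j \<noteq> 1 \<and> lam j \<noteq> -1 \<and> lam j \<noteq> 0"
  shows "int (mat_subspace_dim n (solution_space n J)) =
           D_L a s + D_Z b t + D_one c m + D_minus_one d q + D_P e p lam + D_I n a s"
proof -
  define bs where "bs = concat (map (\<lambda>j. paired_L (s j)) [0..<a]) @
            concat (map (\<lambda>j. paired_Z (t j)) [0..<b]) @
            map (\<lambda>j. Jfin (m j) 1) [0..<c] @
            map (\<lambda>j. Jfin (q j) (-1)) [0..<d] @
            concat (map (\<lambda>j. paired_J (p j) (lam j)) [0..<e])"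
  note dim = dim_solution_space[OF assms(1,2), folded bs_def]
  have n: "n = (\<Sum>x\<leftarrow>bs. nrows (block_act x))" using dim(1) by (simp add: nrows_sum_act)
  have "int (total_count bs) =
      D_L a s + D_Z b t + D_one c m + D_minus_one d q + D_P e p lam + D_I n a s"
    by (rule total_count_structure[OF _ bs_def n]) (rule assms(3))
  then show ?thesis by (simp add: dim(2))
qed

end
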